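(* Let $\mathbb{F}$ be a field of characteristic $0$ or $p > 7$. Every multilinear polynomial identity of degree 7 over $\mathbb{F}$ satisfied by the cyclic commutator $(a,b,c) = abc - bca$ is a consequence of the following three identities (where $(xyz)$ abbreviates the trilinear operation $(x,y,z)$): (1) the ternary Jacobi identity \[ (a,b,c) + (b,c,a) + (c,a,b) \equiv 0; \] (2) the (right) ternary derivation identity \[ ((a,b,c),d,e) \equiv ((a,d,e),b,c) + (a,(b,d,e),c) + (a,b,(c,d,e)); \] (3) the following identity with 45 terms and coefficients $\pm 1$: \begin{align*} & (ab(cd(efg))) - (ab(cf(deg))) - (ab(cf(egd))) - (ab(ce(dgf))) - (ab(cg(fed))) \\ & - (ab(dc(feg))) + (ab(df(cge))) + (ab(de(cfg))) + (ab(de(fgc))) - (ab(fc(dge))) \\ & - (ab(fc(edg))) - (ab(fd(egc))) + (ab(fg(dec))) + (ab(ec(fgd))) + (ab(ed(cgf))) \\ & + (ab(ed(fcg))) - (ab(eg(cfd))) - (ab(eg(dcf))) + (ab(gf(dce))) - (ab(ge(cdf))) \\ & + (ac(fb(deg))) - (ac(gb(dfe))) - (ac(gb(fed))) - (ad(eb(cfg))) - (ad(gb(fce))) \\ & - (ag(db(cfe))) - (ag(db(fec))) + (ag(fb(ced))) - (a(bcd)(efg)) + (a(bcf)(deg)) \\ & - (a(bcg)(dfe)) - (a(bde)(cfg)) - (a(bdg)(fce)) + (a(beg)(dcf)) - (a(bgd)(cfe)) \\ & - (a(bgd)(fec)) + (a(bgf)(ced)) - (a(cbd)(feg)) + (a(cbe)(dfg))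 + (a(cbe)(fgd)) \\ & - (a(cdb)(efg)) + (a(cgb)(fed)) - (a(dbf)(ceg)) - (a(dbf)(egc)) + (a(egb)(dcf)) \equiv 0. \end{align*}
   Context: A ternary algebra over $\mathbb{F}$ is a vector space $T$ with a trilinear operation $(-,-,-)\colon T\times T\times T\to T$ (no further axioms). In an associative algebra over $\mathbb{F}$, the cyclic commutator is the trilinear operation $(a,b,c) = abc - bca$. A multilinear polynomial identity of degree $n$ (for one trilinear operation) is a multilinear element of degree $n$ in the free ternary algebra on $n$ generators, i.e. an $\mathbb{F}$-linear combination of ternary monomials in which each of the $n$ variables occurs exactly once. The symbol $\equiv$ denotes an equation holding for all values of the variables. Such an identity $I$ is satisfied by the cyclic commutator if $I$ vanishes identically in every associative algebra over $\mathbb{F}$ when the ternary operation is interpreted as the cyclic commutator (equivalently, it vanishes in the free associative algebra). An identity $I$ is a consequence of a set $S$ of identities if $I$ holds in every ternary algebra over $\mathbb{F}$ that satisfies all identities in $S$ (equivalently, $I$ lies in the ideal of the free ternary algebra that is generated by $S$ and closed under substitutions). For multilinear $S$ and $I$, this means that $I$ is a linear combination of permutations of variables of the multilinear identities obtained from those in $S$ by repeatedly replacing a variable $x$ by a product $(x,y,z)$ with new variables $y,z$, and by multiplying: $J \mapsto (J,y,z),\ (y,J,z),\ (y,z,J)$. *)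

theory Defs
  imports Complex_Main "HOL-Library.Poly_Mapping"
begin

section \<open>Ternary algebras and multilinear identities\<close>

locale ternary_algebra = vector_space scale
  for scale :: "'k::field \<Rightarrow> 'v::ab_group_add \<Rightarrow> 'v" +
  fixes tri :: "'v \<Rightarrow> 'v \<Rightarrow> 'v \<Rightarrow> 'v"
  assumes linear_1: "Vector_Spaces.linear scale scale (\<lambda>x. tri x y z)"
    and linear_2: "Vector_Spaces.linear scale scale (\<lambda>y. tri x y z)"
    and linear_3: "Vector_Spaces.linear scale scale (\<lambda>z. tri x y z)"

datatype tmonomial =
    Var nat
  | Tri tmonomial tmonomial tmonomial  (\<open>(\<langle>_ _ _\<rangle>)\<close> [1000, 1000, 1000] 1000)

fun vars :: "tmonomial \<Rightarrow> nat list" where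
  "vars (Var i) = [i]"
| "vars \<langle>x y z\<rangle> = vars x @ vars y @ vars z"

text \<open>The ternary monomials are a basis of the free ternary algebra on countably many
  generators, so its elements are the finitely supported functions on \<^typ>\<open>tmonomial\<close>.\<close>

type_synonym 'k tpoly = "tmonomial \<Rightarrow>\<^sub>0 'k"

abbreviation monomial :: "tmonomial \<Rightarrow> 'k::zero_neq_one tpoly"  (\<open>\<lbrakk>_\<rbrakk>\<close>) where
  "\<lbrakk>m\<rbrakk> \<equiv> Poly_Mapping.single m 1"

definition multilinear :: "nat \<Rightarrow> 'k::zero tpoly \<Rightarrow> bool" where
  "multilinear n I \<longleftrightarrow>
     (\<forall>m \<in> Poly_Mapping.keys I. distinct (vars m) \<and> set (vars m) = {..<n})"

fun eval_monomial :: "('v \<Rightarrow> 'v \<Rightarrow> 'v \<Rightarrow> 'v) \<Rightarrow> (nat \<Rightarrow> 'v) \<Rightarrow> tmonomial \<Rightarrow> 'v" where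
  "eval_monomial tri v (Var i) = v i"
| "eval_monomial tri v \<langle>x y z\<rangle> =
     tri (eval_monomial tri v x) (eval_monomial tri v y) (eval_monomial tri v z)"

definition linear_extension ::
    "('k::zero \<Rightarrow> 'v::comm_monoid_add \<Rightarrow> 'v) \<Rightarrow> ('m \<Rightarrow> 'v) \<Rightarrow> ('m \<Rightarrow>\<^sub>0 'k) \<Rightarrow> 'v" where
  "linear_extension scale f p =
     (\<Sum>m \<in> Poly_Mapping.keys p. scale (Poly_Mapping.lookup p m) (f m))"

definition satisfies ::
    "('k::zero \<Rightarrow> 'v::comm_monoid_add \<Rightarrow> 'v) \<Rightarrow> ('v \<Rightarrow> 'v \<Rightarrow> 'v \<Rightarrow> 'v) \<Rightarrow> 'k tpoly \<Rightarrow> bool" where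
  "satisfies scale tri I \<longleftrightarrow>
     (\<forall>v. linear_extension scale (eval_monomial tri v) I = 0)"

text \<open>HOL cannot quantify over types inside a formula, so the underlying type of the ternary
  algebras is a parameter; a theorem that leaves \<open>'v\<close> as a free type variable speaks about
  all ternary algebras.\<close>

definition consequence ::
    "'v::ab_group_add itself \<Rightarrow> 'k::field tpoly set \<Rightarrow> 'k tpoly \<Rightarrow> bool" where
  "consequence _ S I \<longleftrightarrow>
     (\<forall>(scale :: 'k \<Rightarrow> 'v \<Rightarrow> 'v) tri.
        ternary_algebra scale tri \<longrightarrow> (\<forall>J \<in> S. satisfies scale tri J) \<longrightarrow> satisfies scale tri I)"


section \<open>The cyclic commutator\<close>

definition cyclic_commutator :: "'a::ring \<Rightarrow> 'a \<Rightarrow> 'a \<Rightarrow> 'a" where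
  "cyclic_commutator a b c = a * b * c - b * c * a"

text \<open>The free associative algebra on countably many generators is the monoid algebra of the
  free monoid; \<open>word\<close> is a copy of the type of lists that carries the (additively
  written) monoid structure from which \<^theory>\<open>HOL-Library.Poly_Mapping\<close> builds the product.\<close>

datatype word = Word "nat list"

instantiation word :: monoid_add
begin

definition zero_word :: word where
  "0 = Word []"

fun plus_word :: "word \<Rightarrow> word \<Rightarrow> word" where
  "Word xs + Word ys = Word (xs @ ys)"

instance
proof
  fix a b c :: word
  show "a + b + c = a + (b + c)"
    by (cases a; cases b; cases c) simp
  show "0 + a = a" "a + 0 = a"
    by (cases a; simp add: zero_word_def)+
qed

end

type_synonym 'k free_algebra = "word \<Rightarrow>\<^sub>0 'k"

definition free_scale :: "'k::field \<Rightarrow> 'k free_algebra \<Rightarrow> 'k free_algebra" where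
  "free_scale c p = Poly_Mapping.map ((*) c) p"

definition cyclic_commutator_identity :: "'k::field tpoly \<Rightarrow> bool" where
  "cyclic_commutator_identity I \<longleftrightarrow> satisfies free_scale cyclic_commutator I"

text \<open>An element vanishes in the free associative algebra iff it vanishes in every associative
  algebra, unital or not: the free algebra is one of them by \<open>associative_algebra_free\<close>, and
  the converse is \<open>cyclic_commutator_identity_imp_satisfies\<close>.\<close>

locale associative_algebra = vector_space scale
  for scale :: "'k::field \<Rightarrow> 'a::ring \<Rightarrow> 'a" +
  assumes scale_mult_left: "scale c x * y = scale c (x * y)"
    and mult_scale_right: "x * scale c y = scale c (x * y)"

lemma lookup_free_scale:
  "Poly_Mapping.lookup (free_scale c p) w = c * Poly_Mapping.lookup p w"
  by (simp add: free_scale_def Poly_Mapping.map.rep_eq when_def)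

lemma free_scale_conv_mult: "free_scale c p = Poly_Mapping.single 0 c * p"
  by (simp add: free_scale_def mult_map_scale_conv_mult)

lemma mult_single_0_commute:
  fixes p :: "'k::field free_algebra"
  shows "p * Poly_Mapping.single 0 c = Poly_Mapping.single 0 c * p"
proof (induction p rule: update_induct)
  case const
  then show ?case by simp
next
  case (update p w b)
  have "Poly_Mapping.update w b p = p + Poly_Mapping.single w b"
    using update(1) by (intro poly_mapping_eqI)
      (auto simp: lookup_update lookup_add lookup_single when_def in_keys_iff)
  then show ?case
    using update by (simp add: distrib_left distrib_right mult_single mult.commute)
qed

lemma associative_algebra_free: "associative_algebra (free_scale :: 'k::field \<Rightarrow> _)"
proof unfold_locales
  fix c d :: 'k and x y :: "'k free_algebra"
  show "free_scale c (x + y) = free_scale c x + free_scale c y"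
    by (simp add: free_scale_conv_mult distrib_left)
  show "free_scale (c + d) x = free_scale c x + free_scale d x"
    by (simp add: free_scale_conv_mult distrib_right single_add)
  show "free_scale c (free_scale d x) = free_scale (c * d) x"
    by (simp add: free_scale_conv_mult mult_single flip: mult.assoc)
  show "free_scale 1 x = x"
    by (simp add: free_scale_conv_mult)
  show "free_scale c x * y = free_scale c (x * y)"
    by (simp add: free_scale_conv_mult mult.assoc)
  show "x * free_scale c y = free_scale c (x * y)"
    unfolding free_scale_conv_mult by (metis mult_single_0_commute mult.assoc)
qed

lemma (in vector_space) linear_extension_superset:
  assumes "finite A" "Poly_Mapping.keys p \<subseteq> A"
  shows "linear_extension scale f p = (\<Sum>m \<in> A. scale (Poly_Mapping.lookup p m) (f m))"
  unfolding linear_extension_def using assms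
  by (intro sum.mono_neutral_left) (auto simp: in_keys_iff)

lemma (in vector_space) linear_extension_add:
  "linear_extension scale f (p + q) = linear_extension scale f p + linear_extension scale f q"
proof -
  let ?A = "Poly_Mapping.keys p \<union> Poly_Mapping.keys q"
  show ?thesis
    by (subst (1 2 3) linear_extension_superset[of ?A])
      (auto simp: lookup_add scale_left_distrib sum.distrib dest: subsetD[OF Poly_Mapping.keys_add])
qed

lemma (in vector_space) linear_extension_single:
  "linear_extension scale f (Poly_Mapping.single m c) = scale c (f m)"
  by (subst linear_extension_superset[of "{m}"]) auto

lemma (in vector_space) linear_extension_0: "linear_extension scale f 0 = 0"
  by (simp add: linear_extension_def)

lemma (in vector_space) linear_extension_diff:
  "linear_extension scale f (p - q) = linear_extension scale f p - linear_extension scale f q"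
  using linear_extension_add[of f "p - q" q] by (simp add: algebra_simps)

lemma (in vector_space) linear_extension_sum:
  "linear_extension scale f (sum g A) = (\<Sum>i \<in> A. linear_extension scale f (g i))"
  by (induction A rule: infinite_finite_induct)
    (simp_all add: linear_extension_0 linear_extension_add)

lemma (in vector_space) linear_extension_free_scale:
  "linear_extension scale f (free_scale c p) = scale c (linear_extension scale f p)"
proof -
  have "Poly_Mapping.keys (free_scale c p) \<subseteq> Poly_Mapping.keys p"
    by (auto simp: in_keys_iff lookup_free_scale)
  then show ?thesis
    by (subst linear_extension_superset[of "Poly_Mapping.keys p"])
      (auto simp: linear_extension_def lookup_free_scale scale_sum_right)
qed

fun eval_letters :: "(nat \<Rightarrow> 'a::ring) \<Rightarrow> nat list \<Rightarrow> 'a" where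
  "eval_letters v [] = 0"
| "eval_letters v [x] = v x"
| "eval_letters v (x # y # zs) = v x * eval_letters v (y # zs)"

definition eval_word :: "(nat \<Rightarrow> 'a::ring) \<Rightarrow> word \<Rightarrow> 'a" where
  "eval_word v w = (case w of Word xs \<Rightarrow> eval_letters v xs)"

lemma eval_letters_append:
  "xs \<noteq> [] \<Longrightarrow> ys \<noteq> [] \<Longrightarrow> eval_letters v (xs @ ys) = eval_letters v xs * eval_letters v ys"
proof (induction v xs rule: eval_letters.induct)
  case (2 v x)
  then show ?case by (cases ys) auto
qed (auto simp: mult.assoc)

lemma eval_word_plus: "w \<noteq> 0 \<Longrightarrow> u \<noteq> 0 \<Longrightarrow> eval_word v (w + u) = eval_word v w * eval_word v u"
  by (cases w; cases u) (simp add: eval_word_def zero_word_def eval_letters_append)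

lemma poly_mapping_sum_singles:
  "p = (\<Sum>w \<in> Poly_Mapping.keys p. Poly_Mapping.single w (Poly_Mapping.lookup p w))"
  by (rule poly_mapping_eqI) (auto simp: lookup_sum lookup_single when_def in_keys_iff)

lemma (in associative_algebra) linear_extension_mult:
  assumes "0 \<notin> Poly_Mapping.keys p" "0 \<notin> Poly_Mapping.keys q"
  shows "linear_extension scale (eval_word v) (p * q) =
    linear_extension scale (eval_word v) p * linear_extension scale (eval_word v) q"
proof -
  let ?P = "Poly_Mapping.keys p" and ?Q = "Poly_Mapping.keys q"
  have "p * q = (\<Sum>w \<in> ?P. \<Sum>u \<in> ?Q.
      Poly_Mapping.single (w + u) (Poly_Mapping.lookup p w * Poly_Mapping.lookup q u))"
    by (subst poly_mapping_sum_singles[of p], subst poly_mapping_sum_singles[of q])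
      (simp add: sum_product mult_single)
  then have "linear_extension scale (eval_word v) (p * q) = (\<Sum>w \<in> ?P. \<Sum>u \<in> ?Q.
      scale (Poly_Mapping.lookup p w * Poly_Mapping.lookup q u) (eval_word v (w + u)))"
    by (simp add: linear_extension_sum linear_extension_single)
  also have "\<dots> = (\<Sum>w \<in> ?P. \<Sum>u \<in> ?Q.
      scale (Poly_Mapping.lookup p w) (eval_word v w) * scale (Poly_Mapping.lookup q u) (eval_word v u))"
  proof (intro sum.cong refl)
    fix w u assume "w \<in> ?P" "u \<in> ?Q"
    then have "w \<noteq> 0" "u \<noteq> 0" using assms by auto
    then show "scale (Poly_Mapping.lookup p w * Poly_Mapping.lookup q u) (eval_word v (w + u)) =
        scale (Poly_Mapping.lookup p w) (eval_word v w) * scale (Poly_Mapping.lookup q u) (eval_word v u)"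
      by (simp add: eval_word_plus scale_mult_left mult_scale_right)
  qed
  finally show ?thesis by (simp add: linear_extension_def sum_product)
qed

lemma zero_notin_keys_mult:
  fixes p q :: "'k::field free_algebra"
  assumes "0 \<notin> Poly_Mapping.keys p"
  shows "0 \<notin> Poly_Mapping.keys (p * q)"
proof
  assume "0 \<in> Poly_Mapping.keys (p * q)"
  then obtain w u where "w \<in> Poly_Mapping.keys p" "0 = w + u"
    using keys_mult[of p q] by auto
  moreover from this(2) have "w = 0"
    by (cases w; cases u) (simp add: zero_word_def)
  ultimately show False using assms by simp
qed

lemma zero_notin_keys_diff:
  fixes p q :: "'k::field free_algebra"
  shows "0 \<notin> Poly_Mapping.keys p \<Longrightarrow> 0 \<notin> Poly_Mapping.keys q \<Longrightarrow> 0 \<notin> Poly_Mapping.keys (p - q)"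
  by (simp add: in_keys_iff lookup_minus)

lemma cyclic_commutator_identity_imp_satisfies:
  fixes I :: "'k::field tpoly" and scale :: "'k \<Rightarrow> 'a::ring \<Rightarrow> 'a"
  assumes "associative_algebra scale" and "cyclic_commutator_identity I"
  shows "satisfies scale cyclic_commutator I"
  unfolding satisfies_def
proof
  fix v :: "nat \<Rightarrow> 'a"
  interpret associative_algebra scale by fact
  let ?\<phi> = "linear_extension scale (eval_word v)"
  define X :: "nat \<Rightarrow> 'k free_algebra" where "X = (\<lambda>i. Poly_Mapping.single (Word [i]) 1)"
  interpret F: associative_algebra "free_scale :: 'k \<Rightarrow> _"
    by (rule associative_algebra_free)
  have eval: "0 \<notin> Poly_Mapping.keys (eval_monomial cyclic_commutator X m) \<and>
      ?\<phi> (eval_monomial cyclic_commutator X m) = eval_monomial cyclic_commutator v m" for m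
  proof (induction m)
    case (Var i)
    show ?case by (simp add: X_def zero_word_def linear_extension_single eval_word_def)
  next
    case (Tri x y z)
    then show ?case
      by (simp add: cyclic_commutator_def linear_extension_diff linear_extension_mult
          zero_notin_keys_mult zero_notin_keys_diff)
  qed
  have "?\<phi> (linear_extension free_scale (eval_monomial cyclic_commutator X) I) =
      linear_extension scale (eval_monomial cyclic_commutator v) I"
    unfolding linear_extension_def[of free_scale] linear_extension_def[of scale _ I]
    by (simp add: linear_extension_sum linear_extension_free_scale eval)
  moreover have "linear_extension free_scale (eval_monomial cyclic_commutator X) I = 0"
    using assms by (simp add: cyclic_commutator_identity_def satisfies_def)
  ultimately show "linear_extension scale (eval_monomial cyclic_commutator v) I = 0"
    by (simp add: linear_extension_0)
qed


section \<open>The three identities\<close>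

text \<open>An identity \<open>L \<equiv> R\<close> is represented by \<open>L - R\<close>.\<close>

definition ternary_jacobi :: "'k::field tpoly" where
  "ternary_jacobi =
     (let a = Var 0; b = Var 1; c = Var 2
      in \<lbrakk>\<langle>a b c\<rangle>\<rbrakk> + \<lbrakk>\<langle>b c a\<rangle>\<rbrakk> + \<lbrakk>\<langle>c a b\<rangle>\<rbrakk>)"

definition ternary_derivation :: "'k::field tpoly" where
  "ternary_derivation =
     (let a = Var 0; b = Var 1; c = Var 2; d = Var 3; e = Var 4
      in \<lbrakk>\<langle>\<langle>a b c\<rangle> d e\<rangle>\<rbrakk>
         - (\<lbrakk>\<langle>\<langle>a d e\<rangle> b c\<rangle>\<rbrakk> + \<lbrakk>\<langle>a \<langle>b d e\<rangle> c\<rangle>\<rbrakk> + \<lbrakk>\<langle>a b \<langle>c d e\<rangle>\<rangle>\<rbrakk>))"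

definition identity_45 :: "'k::field tpoly" where
  "identity_45 =
     (let a = Var 0; b = Var 1; c = Var 2; d = Var 3; e = Var 4; f = Var 5; g = Var 6
      in \<lbrakk>\<langle>a b \<langle>c d \<langle>e f g\<rangle>\<rangle>\<rangle>\<rbrakk> - \<lbrakk>\<langle>a b \<langle>c f \<langle>d e g\<rangle>\<rangle>\<rangle>\<rbrakk> - \<lbrakk>\<langle>a b \<langle>c f \<langle>e g d\<rangle>\<rangle>\<rangle>\<rbrakk>
        - \<lbrakk>\<langle>a b \<langle>c e \<langle>d g f\<rangle>\<rangle>\<rangle>\<rbrakk> - \<lbrakk>\<langle>a b \<langle>c g \<langle>f e d\<rangle>\<rangle>\<rangle>\<rbrakk> - \<lbrakk>\<langle>a b \<langle>d c \<langle>f e g\<rangle>\<rangle>\<rangle>\<rbrakk>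
        + \<lbrakk>\<langle>a b \<langle>d f \<langle>c g e\<rangle>\<rangle>\<rangle>\<rbrakk> + \<lbrakk>\<langle>a b \<langle>d e \<langle>c f g\<rangle>\<rangle>\<rangle>\<rbrakk> + \<lbrakk>\<langle>a b \<langle>d e \<langle>f g c\<rangle>\<rangle>\<rangle>\<rbrakk>
        - \<lbrakk>\<langle>a b \<langle>f c \<langle>d g e\<rangle>\<rangle>\<rangle>\<rbrakk> - \<lbrakk>\<langle>a b \<langle>f c \<langle>e d g\<rangle>\<rangle>\<rangle>\<rbrakk> - \<lbrakk>\<langle>a b \<langle>f d \<langle>e g c\<rangle>\<rangle>\<rangle>\<rbrakk>
        + \<lbrakk>\<langle>a b \<langle>f g \<langle>d e c\<rangle>\<rangle>\<rangle>\<rbrakk> + \<lbrakk>\<langle>a b \<langle>e c \<langle>f g d\<rangle>\<rangle>\<rangle>\<rbrakk> + \<lbrakk>\<langle>a b \<langle>e d \<langle>c g f\<rangle>\<rangle>\<rangle>\<rbrakk>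
        + \<lbrakk>\<langle>a b \<langle>e d \<langle>f c g\<rangle>\<rangle>\<rangle>\<rbrakk> - \<lbrakk>\<langle>a b \<langle>e g \<langle>c f d\<rangle>\<rangle>\<rangle>\<rbrakk> - \<lbrakk>\<langle>a b \<langle>e g \<langle>d c f\<rangle>\<rangle>\<rangle>\<rbrakk>
        + \<lbrakk>\<langle>a b \<langle>g f \<langle>d c e\<rangle>\<rangle>\<rangle>\<rbrakk> - \<lbrakk>\<langle>a b \<langle>g e \<langle>c d f\<rangle>\<rangle>\<rangle>\<rbrakk> + \<lbrakk>\<langle>a c \<langle>f b \<langle>d e g\<rangle>\<rangle>\<rangle>\<rbrakk>
        - \<lbrakk>\<langle>a c \<langle>g b \<langle>d f e\<rangle>\<rangle>\<rangle>\<rbrakk> - \<lbrakk>\<langle>a c \<langle>g b \<langle>f e d\<rangle>\<rangle>\<rangle>\<rbrakk> - \<lbrakk>\<langle>a d \<langle>e b \<langle>c f g\<rangle>\<rangle>\<rangle>\<rbrakk>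
        - \<lbrakk>\<langle>a d \<langle>g b \<langle>f c e\<rangle>\<rangle>\<rangle>\<rbrakk> - \<lbrakk>\<langle>a g \<langle>d b \<langle>c f e\<rangle>\<rangle>\<rangle>\<rbrakk> - \<lbrakk>\<langle>a g \<langle>d b \<langle>f e c\<rangle>\<rangle>\<rangle>\<rbrakk>
        + \<lbrakk>\<langle>a g \<langle>f b \<langle>c e d\<rangle>\<rangle>\<rangle>\<rbrakk> - \<lbrakk>\<langle>a \<langle>b c d\<rangle> \<langle>e f g\<rangle>\<rangle>\<rbrakk> + \<lbrakk>\<langle>a \<langle>b c f\<rangle> \<langle>d e g\<rangle>\<rangle>\<rbrakk>
        - \<lbrakk>\<langle>a \<langle>b c g\<rangle> \<langle>d f e\<rangle>\<rangle>\<rbrakk> - \<lbrakk>\<langle>a \<langle>b d e\<rangle> \<langle>c f g\<rangle>\<rangle>\<rbrakk> - \<lbrakk>\<langle>a \<langle>b d g\<rangle> \<langle>f c e\<rangle>\<rangle>\<rbrakk>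
        + \<lbrakk>\<langle>a \<langle>b e g\<rangle> \<langle>d c f\<rangle>\<rangle>\<rbrakk> - \<lbrakk>\<langle>a \<langle>b g d\<rangle> \<langle>c f e\<rangle>\<rangle>\<rbrakk> - \<lbrakk>\<langle>a \<langle>b g d\<rangle> \<langle>f e c\<rangle>\<rangle>\<rbrakk>
        + \<lbrakk>\<langle>a \<langle>b g f\<rangle> \<langle>c e d\<rangle>\<rangle>\<rbrakk> - \<lbrakk>\<langle>a \<langle>c b d\<rangle> \<langle>f e g\<rangle>\<rangle>\<rbrakk> + \<lbrakk>\<langle>a \<langle>c b e\<rangle> \<langle>d f g\<rangle>\<rangle>\<rbrakk>
        + \<lbrakk>\<langle>a \<langle>c b e\<rangle> \<langle>f g d\<rangle>\<rangle>\<rbrakk> - \<lbrakk>\<langle>a \<langle>c d b\<rangle> \<langle>e f g\<rangle>\<rangle>\<rbrakk> + \<lbrakk>\<langle>a \<langle>c g b\<rangle> \<langle>f e d\<rangle>\<rangle>\<rbrakk>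
        - \<lbrakk>\<langle>a \<langle>d b f\<rangle> \<langle>c e g\<rangle>\<rangle>\<rbrakk> - \<lbrakk>\<langle>a \<langle>d b f\<rangle> \<langle>e g c\<rangle>\<rangle>\<rbrakk> + \<lbrakk>\<langle>a \<langle>e g b\<rangle> \<langle>d c f\<rangle>\<rangle>\<rbrakk>)"

end

(* Since (a,b,c) = [a,bc], a ternary monomial m expands into associative words; let pi m be the
   expansion. It suffices to factor the evaluation of monomials of degree 7 in an algebra
   satisfying (1)-(3) as psi o pi with psi linear. By (1) and (2) every monomial is a combination
   of monomials (x,P,R) whose first entry x is a variable other than a fixed one, and pi (x,P,R)
   is x w - w x with w = (pi P)(pi R). So psi can be solved from psi(x w) - psi(w x) = theta(x,w)
   as soon as there is a theta with theta(x, (pi P)(pi R)) = (x,P,R) for all P, R.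
   Such a theta exists iff D_PR = (-,P,R), extended linearly in P (x) R, is zero on the kernel of
   P (x) R |-> (pi P)(pi R). In degree 4 this kernel comes from [D_PQ, D_RS] = - [D_RS, D_PQ]; in
   degree 6 it is generated, as a module over the symmetric group, by these relations and by the
   left-hand side of (3), which is the value at a of a combination of derivations D_PR. In both
   degrees theta is given by explicit coefficients, with denominators 12 and 360. *)

theory Submission
  imports Defs "HOL-Library.Multiset"
begin

section \<open>Expansion into associative words\<close>

text \<open>A word of two letters can be split in only one way, so degree 3 meets no obstruction.
  The difficulty begins with words of length 4 and 6, where one product word arises from several
  splits. There theta is sought as a weighted sum of values D_PR on permuted copies of a few generic
  pairs P, R. One list of coefficients then serves every choice of letters, and its correctness is a
  finite integer computation: for each shape of P, R, the unnormalized theta of the product word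
  differs from d times P (x) R by a combination of relations, where d is 12 or 360.

  Every monomial has odd degree, so a cyclic commutator moves a block of odd length past a block of
  even length. All words in the expansion of a multilinear monomial therefore differ by even
  permutations, and only alternating groups enter. The denominators 12 and 360 are the orders of
  these groups on 4 and 6 letters.\<close>

text \<open>\<open>W m f\<close> is the sum of \<open>f\<close> over the signed words into which \<open>m\<close> expands under the cyclic commutator.
  The continuation-passing form makes the identities (1) and (2) for \<open>W\<close> instances of
  exchanging two summations.\<close>

fun W :: "tmonomial \<Rightarrow> (nat list \<Rightarrow> 'v::ab_group_add) \<Rightarrow> 'v" where
  "W (Var i) f = f [i]"
| "W \<langle>x y z\<rangle> f =
     W x (\<lambda>p. W y (\<lambda>q. W z (\<lambda>r. f (p @ q @ r)))) - W x (\<lambda>p. W y (\<lambda>q. W z (\<lambda>r. f (q @ r @ p))))"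

lemma W_diff: "W m (\<lambda>w. f w - g w) = W m f - W m g"
  by (induction m arbitrary: f g) simp_all

lemma W_swap: "W x (\<lambda>p. W y (\<lambda>q. f p q)) = W y (\<lambda>q. W x (\<lambda>p. f p q))"
  by (induction x arbitrary: f) (simp_all add: W_diff)

text \<open>Both terms of a product concatenate the same three factors, so each word of the
  expansion rearranges \<open>vars m\<close>. A continuation may thus be changed on all other words,
  in particular on words of another length or with another letter set.\<close>

lemma W_cong:
  assumes "\<And>w. mset w = mset (vars m) \<Longrightarrow> f w = g w"
  shows "W m f = W m g"
  using assms
proof (induction m arbitrary: f g)
  case (Tri x y z)
  have "W x (\<lambda>p. W y (\<lambda>q. W z (\<lambda>r. f (p @ q @ r)))) = W x (\<lambda>p. W y (\<lambda>q. W z (\<lambda>r. g (p @ q @ r))))"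
    by (rule Tri.IH(1), rule Tri.IH(2), rule Tri.IH(3), rule Tri.prems) (simp add: ac_simps)
  moreover have "W x (\<lambda>p. W y (\<lambda>q. W z (\<lambda>r. f (q @ r @ p)))) = W x (\<lambda>p. W y (\<lambda>q. W z (\<lambda>r. g (q @ r @ p))))"
    by (rule Tri.IH(1), rule Tri.IH(2), rule Tri.IH(3), rule Tri.prems) (simp add: ac_simps)
  ultimately show ?case by simp
qed simp

lemma W_rotate:
  "W y (\<lambda>q. W z (\<lambda>r. W x (\<lambda>p. g q r p))) = W x (\<lambda>p. W y (\<lambda>q. W z (\<lambda>r. g q r p)))"
  by (subst (2) W_swap, subst W_swap) (rule refl)

text \<open>The subtracted word of each summand is the leading word of the next, in cyclic order.
  Only the order of summation has to be aligned.\<close>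

lemma W_jacobi: "W \<langle>x y z\<rangle> f + W \<langle>y z x\<rangle> f + W \<langle>z x y\<rangle> f = 0"
  using W_rotate[of y z x "\<lambda>q r p. f (q @ r @ p)"] W_rotate[of y z x "\<lambda>q r p. f (p @ q @ r)"]
    W_rotate[of z x y "\<lambda>r p q. f (p @ q @ r)"] W_rotate[of z x y "\<lambda>r p q. f (r @ p @ q)"]
    W_rotate[of x y z "\<lambda>p q r. f (r @ p @ q)"]
  by simp

text \<open>For fixed w, here the product of the expansions of d and e, the map [-, w] is a
  derivation of the associative product.\<close>

lemma W_derivation:
  "W \<langle>\<langle>a b c\<rangle> d e\<rangle> f = W \<langle>\<langle>a d e\<rangle> b c\<rangle> f + W \<langle>a \<langle>b d e\<rangle> c\<rangle> f + W \<langle>a b \<langle>c d e\<rangle>\<rangle> f"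
proof -
  have 1: "W d (\<lambda>s. W e (\<lambda>t. W b (\<lambda>q. W c (\<lambda>r. g q r s t)))) =
      W b (\<lambda>q. W c (\<lambda>r. W d (\<lambda>s. W e (\<lambda>t. g q r s t))))" for g
    by (subst (2) W_swap, subst (3) W_swap, subst (1) W_swap, subst (2) W_swap) (rule refl)
  have 2: "W d (\<lambda>s. W e (\<lambda>t. W c (\<lambda>r. g r s t))) = W c (\<lambda>r. W d (\<lambda>s. W e (\<lambda>t. g r s t)))" for g
    by (subst (2) W_swap, subst W_swap) (rule refl)
  show ?thesis by (simp add: W_diff 1 2)
qed

section \<open>Linear functionals on the free associative algebra\<close>

definition word_sum ::
    "('k::field \<Rightarrow> 'v \<Rightarrow> 'v) \<Rightarrow> (nat list \<Rightarrow> 'v::ab_group_add) \<Rightarrow> 'k free_algebra \<Rightarrow> 'v" where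
  "word_sum scale f = linear_extension scale (case_word f)"

context vector_space
begin

lemma word_sum_diff: "word_sum scale f (p - q) = word_sum scale f p - word_sum scale f q"
  by (simp add: word_sum_def linear_extension_diff)

lemma word_sum_mult:
  "word_sum scale f (p * q) = word_sum scale (\<lambda>x. word_sum scale (\<lambda>y. f (x @ y)) q) p"
proof -
  let ?P = "Poly_Mapping.keys p" and ?Q = "Poly_Mapping.keys q"
  have "p * q = (\<Sum>w \<in> ?P. \<Sum>u \<in> ?Q.
      Poly_Mapping.single (w + u) (Poly_Mapping.lookup p w * Poly_Mapping.lookup q u))"
    by (subst poly_mapping_sum_singles[of p], subst poly_mapping_sum_singles[of q])
      (simp add: sum_product mult_single)
  then have "word_sum scale f (p * q) = (\<Sum>w \<in> ?P. \<Sum>u \<in> ?Q.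
      scale (Poly_Mapping.lookup p w * Poly_Mapping.lookup q u) (case_word f (w + u)))"
    by (simp add: word_sum_def linear_extension_sum linear_extension_single)
  also have "\<dots> = (\<Sum>w \<in> ?P. scale (Poly_Mapping.lookup p w) (case_word (\<lambda>x.
      \<Sum>u \<in> ?Q. scale (Poly_Mapping.lookup q u) (case_word (\<lambda>y. f (x @ y)) u)) w))"
    by (auto simp: scale_sum_right split: word.split intro!: sum.cong)
  finally show ?thesis by (simp add: word_sum_def linear_extension_def)
qed

lemma word_sum_cyclic_commutator:
  "word_sum scale f (cyclic_commutator p q r) =
    word_sum scale (\<lambda>x. word_sum scale (\<lambda>y. word_sum scale (\<lambda>z. f (x @ y @ z)) r) q) p -
    word_sum scale (\<lambda>y. word_sum scale (\<lambda>z. word_sum scale (\<lambda>x. f (y @ z @ x)) p) r) q"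
  by (simp add: cyclic_commutator_def word_sum_diff word_sum_mult)

text \<open>This ties \<open>W\<close> to the free algebra: a functional given on words sees a
  monomial evaluated at the generators exactly through \<open>W m f\<close>.\<close>

lemma word_sum_eval_monomial:
  "word_sum scale f (eval_monomial cyclic_commutator (\<lambda>i. Poly_Mapping.single (Word [i]) 1) m) = W m f"
proof (induction m arbitrary: f)
  case (Var i)
  then show ?case by (simp add: word_sum_def linear_extension_single)
next
  case (Tri x y z)
  show ?case
    using W_rotate[of y z x "\<lambda>q r p. f (q @ r @ p)"]
    by (simp add: word_sum_cyclic_commutator Tri.IH)
qed

end

section \<open>Reduction to monomials with a variable in first position\<close>

text \<open>If the first entry (a b c) avoids l, (2) moves the outer pair y, z inside, and (1)
  rotates the one summand whose first entry is (a y z). All four resulting monomials start with a, b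
  or c, so induction on the first entry applies. If the first entry contains l, both rotations
  supplied by (1) start with an entry avoiding l.\<close>

lemma leaf_first_induct:
  fixes F :: "tmonomial \<Rightarrow> 'v::ab_group_add"
  assumes jacobi: "\<And>x y z. F \<langle>x y z\<rangle> + F \<langle>y z x\<rangle> + F \<langle>z x y\<rangle> = 0"
    and derivation: "\<And>a b c d e. F \<langle>\<langle>a b c\<rangle> d e\<rangle> =
      F \<langle>\<langle>a d e\<rangle> b c\<rangle> + F \<langle>a \<langle>b d e\<rangle> c\<rangle> + F \<langle>a b \<langle>c d e\<rangle>\<rangle>"
    and leaf: "\<And>i y z. i \<noteq> l \<Longrightarrow> distinct (vars \<langle>(Var i) y z\<rangle>) \<Longrightarrow>
      set (vars \<langle>(Var i) y z\<rangle>) = S \<Longrightarrow> F \<langle>(Var i) y z\<rangle> = 0"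
    and xyz: "distinct (vars \<langle>x y z\<rangle>)" "set (vars \<langle>x y z\<rangle>) = S"
  shows "F \<langle>x y z\<rangle> = 0"
proof -
  have *: "F \<langle>x y z\<rangle> = 0"
    if "l \<notin> set (vars x)" "distinct (vars \<langle>x y z\<rangle>)" "set (vars \<langle>x y z\<rangle>) = S" for x y z
    using that
  proof (induction x arbitrary: y z)
    case (Var i)
    then show ?case by (intro leaf) auto
  next
    case (Tri a b c)
    have "F \<langle>a \<langle>b y z\<rangle> c\<rangle> = 0" "F \<langle>a b \<langle>c y z\<rangle>\<rangle> = 0"
      using Tri.prems by (intro Tri.IH; auto)+
    moreover have "F \<langle>b c \<langle>a y z\<rangle>\<rangle> = 0" "F \<langle>c \<langle>a y z\<rangle> b\<rangle> = 0"
      using Tri.prems by (intro Tri.IH; auto)+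
    ultimately show ?case
      using derivation[of a b c y z] jacobi[of "\<langle>a y z\<rangle>" b c] by simp
  qed
  show ?thesis
  proof (cases "l \<in> set (vars x)")
    case True
    then have "F \<langle>y z x\<rangle> = 0" "F \<langle>z x y\<rangle> = 0"
      using xyz by (intro *; auto)+
    then show ?thesis using jacobi[of x y z] by simp
  qed (use * xyz in blast)
qed

text \<open>For fixed letters, \<open>word_potential \<theta>\<close> solves \<open>\<psi> (i # u) - \<psi> (u @ [i]) = \<theta> i u\<close> for all \<open>i\<close> but the
  least letter: the rotations of a word then form a path starting at the word that begins with
  the least letter, where the value is set to \<open>0\<close>.\<close>

definition word_potential :: "(nat \<Rightarrow> nat list \<Rightarrow> 'v::ab_group_add) \<Rightarrow> nat list \<Rightarrow> 'v" where
  "word_potential \<theta> w =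
     (\<Sum>j < length (takeWhile (\<lambda>i. i \<noteq> Min (set w)) w). \<theta> (w ! j) (tl (rotate j w)))"

text \<open>Moving \<open>i\<close> to the end shortens the prefix before the least letter by one.
  The remaining rotations are the same, so the two sums differ exactly in the summand j = 0.\<close>

lemma word_potential_Cons:
  assumes "i \<noteq> Min (set (i # u))"
  shows "word_potential \<theta> (i # u) - word_potential \<theta> (u @ [i]) = \<theta> i u"
proof -
  define M where "M = Min (set (i # u))"
  have "M \<in> set (i # u)" unfolding M_def by (rule Min_in) auto
  with assms have M: "M \<in> set u" "i \<noteq> M" by (auto simp: M_def)
  have [simp]: "Min (insert i (set u)) = M" by (simp add: M_def)
  have tw: "takeWhile (\<lambda>i. i \<noteq> M) (u @ [i]) = takeWhile (\<lambda>i. i \<noteq> M) u"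
    using M(1) by (intro takeWhile_append1) auto
  define k where "k = length (takeWhile (\<lambda>i. i \<noteq> M) u)"
  have k: "k \<le> length u" by (simp add: k_def length_takeWhile_le)
  have "word_potential \<theta> (i # u) = (\<Sum>j < Suc k. \<theta> ((i # u) ! j) (tl (rotate j (i # u))))"
    using M by (simp add: word_potential_def k_def)
  also have "\<dots> = \<theta> i u + (\<Sum>j < k. \<theta> ((i # u) ! Suc j) (tl (rotate (Suc j) (i # u))))"
    by (subst sum.lessThan_Suc_shift) simp
  also have "(\<Sum>j < k. \<theta> ((i # u) ! Suc j) (tl (rotate (Suc j) (i # u)))) = word_potential \<theta> (u @ [i])"
    using k by (auto simp: word_potential_def tw k_def[symmetric] nth_append rotate1_rotate_swap
        intro!: sum.cong)
  finally show ?thesis by simp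
qed

lemma length_vars: "odd (length (vars m))"
  by (induction m) auto

lemma length_vars_eq_1: "length (vars m) = 1 \<Longrightarrow> \<exists>i. m = Var i"
proof (cases m)
  case (Tri x y z)
  assume "length (vars m) = 1"
  then show ?thesis using length_vars[of x] length_vars[of y] length_vars[of z] Tri
    by (auto elim!: oddE)
qed auto

lemma length_vars_eq_3: "length (vars m) = 3 \<Longrightarrow> \<exists>i j k. m = \<langle>(Var i) (Var j) (Var k)\<rangle>"
proof (cases m)
  case (Tri x y z)
  assume "length (vars m) = 3"
  then have "length (vars x) = 1" "length (vars y) = 1" "length (vars z) = 1"
    using length_vars[of x] length_vars[of y] length_vars[of z] Tri
    by (auto elim!: oddE)
  then show ?thesis using Tri length_vars_eq_1 by metis
qed auto

section \<open>Algebras satisfying the Jacobi and derivation identities\<close>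

locale jacobi_derivation_algebra = ternary_algebra +
  assumes jacobi: "tri a b c + tri b c a + tri c a b = 0"
    and derivation: "tri (tri a b c) d e = tri (tri a d e) b c + tri a (tri b d e) c + tri a b (tri c d e)"
begin

lemma tri_diff_2: "tri x (a - b) z = tri x a z - tri x b z"
  using module_hom.diff[of scale scale "\<lambda>y. tri x y z"] linear_2[of x z]
  by (simp add: Vector_Spaces.linear_def)

lemma tri_diff_3: "tri x y (a - b) = tri x y a - tri x y b"
  using module_hom.diff[of scale scale "tri x y"] linear_3[of x y]
  by (simp add: Vector_Spaces.linear_def)

lemma tri_W_2: "tri x (W m f) z = W m (\<lambda>p. tri x (f p) z)"
  by (induction m arbitrary: f) (simp_all add: tri_diff_2)

lemma tri_W_3: "tri x y (W m f) = W m (\<lambda>p. tri x y (f p))"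
  by (induction m arbitrary: f) (simp_all add: tri_diff_3)

text \<open>Apply (2) to both ((x,p,q),r,s) and ((x,r,s),p,q). On adding the two instances the
  double products on x cancel, and the terms with a product inside the second or third entry
  remain.\<close>

lemma tri_commutator:
  "tri x (tri p r s) q + tri x p (tri q r s) + tri x (tri r p q) s + tri x r (tri s p q) = 0"
  using derivation[of x p q r s] derivation[of x r s p q] by (simp add: algebra_simps)

text \<open>The difference \<open>F\<close> of the two sides satisfies (1) and (2), because both the
  algebra and \<open>W\<close> do. Hence it suffices to treat monomials led by a variable, where the
  assumption on \<open>\<theta>\<close> meets the difference equation of the potential.\<close>

lemma word_potential_correct:
  assumes \<theta>: "\<And>i y z. distinct (vars \<langle>(Var i) y z\<rangle>) \<Longrightarrow> length (vars \<langle>(Var i) y z\<rangle>) = n \<Longrightarrow>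
      tri (v i) (eval_monomial tri v y) (eval_monomial tri v z) =
        W y (\<lambda>p. W z (\<lambda>r. \<theta> i (p @ r)))"
    and m: "distinct (vars m)" "length (vars m) = n" "n \<noteq> 1"
  shows "eval_monomial tri v m = W m (word_potential \<theta>)"
proof -
  obtain x y z where xyz: "m = \<langle>x y z\<rangle>" using m by (cases m) auto
  define F where "F = (\<lambda>m. eval_monomial tri v m - W m (word_potential \<theta>))"
  define S where "S = set (vars m)"
  have "F \<langle>x y z\<rangle> = 0"
  proof (rule leaf_first_induct[where l = "Min S" and S = S])
    show "F \<langle>x y z\<rangle> + F \<langle>y z x\<rangle> + F \<langle>z x y\<rangle> = 0" for x y z
    proof -
      let ?e = "\<lambda>x y z. eval_monomial tri v \<langle>x y z\<rangle>" and ?w = "\<lambda>x y z. W \<langle>x y z\<rangle> (word_potential \<theta>)"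
      have "F \<langle>x y z\<rangle> + F \<langle>y z x\<rangle> + F \<langle>z x y\<rangle> =
          (?e x y z + ?e y z x + ?e z x y) - (?w x y z + ?w y z x + ?w z x y)"
        unfolding F_def by (simp only: algebra_simps)
      also have "\<dots> = 0"
        by (simp only: W_jacobi eval_monomial.simps jacobi) simp
      finally show ?thesis .
    qed
    show "F \<langle>\<langle>a b c\<rangle> d e\<rangle> = F \<langle>\<langle>a d e\<rangle> b c\<rangle> + F \<langle>a \<langle>b d e\<rangle> c\<rangle> + F \<langle>a b \<langle>c d e\<rangle>\<rangle>" for a b c d e
      unfolding F_def W_derivation[of a b c d e]
      by (simp only: eval_monomial.simps derivation[of _ "eval_monomial tri v b"]) (simp only: algebra_simps)
    show "F \<langle>(Var i) y z\<rangle> = 0"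
      if "i \<noteq> Min S" "distinct (vars \<langle>(Var i) y z\<rangle>)" "set (vars \<langle>(Var i) y z\<rangle>) = S" for i y z
    proof -
      have "length (vars \<langle>(Var i) y z\<rangle>) = n"
        using that(2,3) m S_def by (metis distinct_card)
      then have "eval_monomial tri v \<langle>(Var i) y z\<rangle> = W y (\<lambda>p. W z (\<lambda>r. \<theta> i (p @ r)))"
        using \<theta>[OF that(2)] by simp
      \<comment> \<open>Each word \<open>i # p @ r\<close> met here has letter set \<open>S\<close>,
        so its least letter is always \<open>Min S\<close>, which differs from
        \<open>i\<close>.\<close>
      also have "\<dots> = W y (\<lambda>p. W z (\<lambda>r. word_potential \<theta> (i # p @ r) - word_potential \<theta> (p @ r @ [i])))"
      proof (intro W_cong)
        fix p r assume "mset p = mset (vars y)" "mset r = mset (vars z)"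
        then have "set p = set (vars y)" "set r = set (vars z)" by (metis set_mset_mset)+
        then have "set (i # p @ r) = S" using that(3) by auto
        then show "\<theta> i (p @ r) = word_potential \<theta> (i # p @ r) - word_potential \<theta> (p @ r @ [i])"
          using word_potential_Cons[of i "p @ r" \<theta>] that(1) by simp
      qed
      also have "\<dots> = W \<langle>(Var i) y z\<rangle> (word_potential \<theta>)" by (simp add: W_diff)
      finally show ?thesis by (simp add: F_def)
    qed
    show "distinct (vars \<langle>x y z\<rangle>)" "set (vars \<langle>x y z\<rangle>) = S"
      using m xyz by (auto simp: S_def)
  qed
  then show ?thesis by (simp add: F_def xyz)
qed

end

section \<open>Certificates\<close>

datatype pos = p1 | p2 | p3 | p4 | p5 | p6

primrec pos_index :: "pos \<Rightarrow> nat" where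
  "pos_index p1 = 0"
| "pos_index p2 = 1"
| "pos_index p3 = 2"
| "pos_index p4 = 3"
| "pos_index p5 = 4"
| "pos_index p6 = 5"

definition letter :: "'a list \<Rightarrow> pos \<Rightarrow> 'a" where
  "letter w p = w ! pos_index p"

lemma letter_simps:
  "letter (a # w) p1 = a"
  "letter (a # b # w) p2 = b"
  "letter (a # b # c # w) p3 = c"
  "letter (a # b # c # d # w) p4 = d"
  "letter (a # b # c # d # e # w) p5 = e"
  "letter (a # b # c # d # e # f # w) p6 = f"
  by (simp_all add: letter_def)

definition pos_of :: "nat \<Rightarrow> pos" where
  "pos_of n = (if n = 0 then p1 else if n = 1 then p2 else if n = 2 then p3
     else if n = 3 then p4 else if n = 4 then p5 else p6)"

lemma pos_of_simps:
  "pos_of 0 = p1" "pos_of 1 = p2" "pos_of 2 = p3" "pos_of 3 = p4" "pos_of 4 = p5" "pos_of 5 = p6"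
  by (simp_all add: pos_of_def)

lemma letter_pos_of: "n < 6 \<Longrightarrow> letter w (pos_of n) = w ! n"
  by (auto simp: pos_of_def letter_def less_Suc_eq numeral_eq_Suc)

text \<open>A formal sum of terms \<open>(c, t, u)\<close>: the coefficient \<open>c\<close>, the position \<open>t\<close> after which the
  word \<open>u\<close> is split into two factors, and \<open>u\<close>, a rearrangement of the positions of a generic word.\<close>

type_synonym form = "(int \<times> pos \<times> pos list) list"

text \<open>An entry \<open>(b, rs, kss)\<close> stands for the sum of \<open>k\<close> times \<open>b\<close> with its positions permuted by \<open>g\<close>, over
  the matching entries \<open>g\<close> of \<open>rs\<close> and \<open>k\<close> of \<open>kss\<close>. The division into rows only keeps the
  intermediate tries of the evaluation small.\<close>

type_synonym combination = "(form \<times> pos list list list \<times> int list list) list"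

text \<open>Tries collect equal words during evaluation by the simplifier. \<open>Mix\<close> only arises when words
  of different lengths meet; it keeps \<open>add_trie\<close> correct without a well-formedness condition.\<close>

datatype trie = Empty | Leaf int | Node trie trie trie trie trie trie | Mix trie trie

fun single_trie :: "pos list \<Rightarrow> int \<Rightarrow> trie" where
  "single_trie [] c = Leaf c"
| "single_trie (p1 # u) c = Node (single_trie u c) Empty Empty Empty Empty Empty"
| "single_trie (p2 # u) c = Node Empty (single_trie u c) Empty Empty Empty Empty"
| "single_trie (p3 # u) c = Node Empty Empty (single_trie u c) Empty Empty Empty"
| "single_trie (p4 # u) c = Node Empty Empty Empty (single_trie u c) Empty Empty"
| "single_trie (p5 # u) c = Node Empty Empty Empty Empty (single_trie u c) Empty"
| "single_trie (p6 # u) c = Node Empty Empty Empty Empty Empty (single_trie u c)"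

fun add_trie :: "trie \<Rightarrow> trie \<Rightarrow> trie" where
  "add_trie Empty t = t"
| "add_trie (Leaf a) Empty = Leaf a"
| "add_trie (Leaf a) (Leaf b) = Leaf (a + b)"
| "add_trie (Leaf a) (Node t1 t2 t3 t4 t5 t6) = Mix (Leaf a) (Node t1 t2 t3 t4 t5 t6)"
| "add_trie (Leaf a) (Mix s t) = Mix (Leaf a) (Mix s t)"
| "add_trie (Node s1 s2 s3 s4 s5 s6) Empty = Node s1 s2 s3 s4 s5 s6"
| "add_trie (Node s1 s2 s3 s4 s5 s6) (Leaf a) = Mix (Node s1 s2 s3 s4 s5 s6) (Leaf a)"
| "add_trie (Node s1 s2 s3 s4 s5 s6) (Node t1 t2 t3 t4 t5 t6) =
     Node (add_trie s1 t1) (add_trie s2 t2) (add_trie s3 t3)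
       (add_trie s4 t4) (add_trie s5 t5) (add_trie s6 t6)"
| "add_trie (Node s1 s2 s3 s4 s5 s6) (Mix s t) = Mix (Node s1 s2 s3 s4 s5 s6) (Mix s t)"
| "add_trie (Mix s t) r = Mix (Mix s t) r"

fun zero_trie :: "trie \<Rightarrow> bool" where
  "zero_trie Empty = True"
| "zero_trie (Leaf a) = (a = 0)"
| "zero_trie (Node t1 t2 t3 t4 t5 t6) =
     (zero_trie t1 \<and> zero_trie t2 \<and> zero_trie t3 \<and> zero_trie t4 \<and> zero_trie t5 \<and> zero_trie t6)"
| "zero_trie (Mix s t) = False"

fun trie_words :: "trie \<Rightarrow> (int \<times> pos list) list" where
  "trie_words Empty = []"
| "trie_words (Leaf a) = (if a = 0 then [] else [(a, [])])"
| "trie_words (Node t1 t2 t3 t4 t5 t6) =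
     map (\<lambda>(c, u). (c, p1 # u)) (trie_words t1) @ map (\<lambda>(c, u). (c, p2 # u)) (trie_words t2) @
     map (\<lambda>(c, u). (c, p3 # u)) (trie_words t3) @ map (\<lambda>(c, u). (c, p4 # u)) (trie_words t4) @
     map (\<lambda>(c, u). (c, p5 # u)) (trie_words t5) @ map (\<lambda>(c, u). (c, p6 # u)) (trie_words t6)"
| "trie_words (Mix s t) = trie_words s @ trie_words t"

text \<open>The split position becomes the leading letter of a trie word, so equal words with
  different splits are not merged. This is the source of the pattern \<open>f (hd x) (tl x)\<close>
  in the evaluation lemmas.\<close>

fun form_trie :: "pos list \<Rightarrow> int \<Rightarrow> form \<Rightarrow> trie" where
  "form_trie g k [] = Empty"
| "form_trie g k ((c, t, u) # b) = add_trie (single_trie (t # map (letter g) u) (k * c)) (form_trie g k b)"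

fun row_trie :: "pos list \<Rightarrow> int \<Rightarrow> form \<Rightarrow> pos list list \<Rightarrow> int list \<Rightarrow> trie" where
  "row_trie h s b (g # gs) (k # ks) =
     add_trie (form_trie (map (letter h) g) (s * k) b) (row_trie h s b gs ks)"
| "row_trie h s b gs [] = Empty"
| "row_trie h s b [] (k # ks) = Empty"

fun comb_trie :: "pos list \<Rightarrow> int \<Rightarrow> form \<Rightarrow> pos list list list \<Rightarrow> int list list \<Rightarrow> trie" where
  "comb_trie h s b (r # rs) (ks # kss) = add_trie (row_trie h s b r ks) (comb_trie h s b rs kss)"
| "comb_trie h s b rs [] = Empty"
| "comb_trie h s b [] (ks # kss) = Empty"

definition tensor :: "(int \<times> pos list) list \<Rightarrow> (int \<times> pos list) list \<Rightarrow> (int \<times> pos list) list" where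
  "tensor l m = concat (map (\<lambda>(a, p). map (\<lambda>(b, q). (a * b, p @ q)) m) l)"

text \<open>A list version of \<open>W\<close> on positions, which rewriting can compute;
  \<open>sum_list_expand\<close> relates the two.\<close>

fun expand :: "tmonomial \<Rightarrow> (int \<times> pos list) list" where
  "expand (Var i) = [(1, [pos_of i])]"
| "expand \<langle>x y z\<rangle> = tensor (expand x) (tensor (expand y) (expand z)) @
     map (\<lambda>(a, p). (- a, p)) (tensor (expand y) (tensor (expand z) (expand x)))"

text \<open>Positions are counted from 0: a left factor of length k ends at index k - 1, and
  \<open>Suc (pos_index t)\<close> recovers k.\<close>

definition split_pos :: "pos list \<Rightarrow> pos" where
  "split_pos p = pos_of (length p - 1)"

lemma split_pos_simps:
  "split_pos [a] = p1" "split_pos [a, b, c] = p3" "split_pos [a, b, c, d, e] = p5"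
  by (simp_all add: split_pos_def pos_of_def)

fun pair_form :: "(int \<times> tmonomial \<times> tmonomial) list \<Rightarrow> form" where
  "pair_form [] = []"
| "pair_form ((c, x, y) # l) =
     concat (map (\<lambda>(a, p). map (\<lambda>(b, q). (c * (a * b), split_pos p, p @ q)) (expand y)) (expand x)) @
     pair_form l"

definition normalize :: "form \<Rightarrow> form" where
  "normalize b = map (\<lambda>(c, u). (c, hd u, tl u)) (trie_words (form_trie [p1, p2, p3, p4, p5, p6] 1 b))"

fun data_trie :: "pos list \<Rightarrow> int \<Rightarrow> combination \<Rightarrow> trie" where
  "data_trie h s [] = Empty"
| "data_trie h s ((b, rs, kss) # l) = add_trie (comb_trie h s b rs kss) (data_trie h s l)"

text \<open>The split \<open>t\<close> of each term is discarded on purpose: this is theta applied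
  after multiplication, and theta must depend on the product word alone.\<close>

fun subst_trie :: "combination \<Rightarrow> form \<Rightarrow> trie" where
  "subst_trie l [] = Empty"
| "subst_trie l ((s, t, h) # b) = add_trie (data_trie h s l) (subst_trie l b)"

lemma letter_id: "letter [p1, p2, p3, p4, p5, p6] p = p"
  by (cases p) (simp_all add: letter_simps)

lemma map_letter_id: "map (letter [p1, p2, p3, p4, p5, p6]) u = u"
  by (simp add: letter_id map_idI)

lemma map_letter_map_letter:
  assumes "\<forall>p \<in> set u. pos_index p < length g"
  shows "map (letter w) (map (letter g) u) = map (letter (map (letter w) g)) u"
  using assms by (auto simp: letter_def)

definition positions_below :: "nat \<Rightarrow> pos list \<Rightarrow> bool" where
  "positions_below n u \<longleftrightarrow> (\<forall>p \<in> set u. pos_index p < n)"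

definition form_below :: "nat \<Rightarrow> form \<Rightarrow> bool" where
  "form_below n b \<longleftrightarrow> (\<forall>(c, t, u) \<in> set b. positions_below n u)"

definition permutations_below :: "nat \<Rightarrow> pos list list list \<Rightarrow> bool" where
  "permutations_below n rs \<longleftrightarrow>
     (\<forall>r \<in> set rs. \<forall>g \<in> set r. length g = n \<and> distinct g \<and> positions_below n g)"

definition data_below :: "nat \<Rightarrow> combination \<Rightarrow> bool" where
  "data_below n l \<longleftrightarrow> (\<forall>(b, rs, kss) \<in> set l. form_below n b \<and> permutations_below n rs)"

lemma pos_index_inject: "pos_index p = pos_index q \<longleftrightarrow> p = q"
  by (cases p; cases q) simp_all

lemma distinct_map_letter:
  assumes "distinct w" "distinct g" "positions_below (length w) g"
  shows "distinct (map (letter w) g)"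
  using assms unfolding distinct_map
  by (auto simp: inj_on_def letter_def positions_below_def nth_eq_iff_index_eq pos_index_inject)

section \<open>Values of formal sums in the algebra\<close>

context jacobi_derivation_algebra
begin

fun trie_sum :: "(pos list \<Rightarrow> 'b) \<Rightarrow> trie \<Rightarrow> 'b" where
  "trie_sum f Empty = 0"
| "trie_sum f (Leaf c) = scale (of_int c) (f [])"
| "trie_sum f (Node t1 t2 t3 t4 t5 t6) =
     trie_sum (\<lambda>u. f (p1 # u)) t1 + trie_sum (\<lambda>u. f (p2 # u)) t2 + trie_sum (\<lambda>u. f (p3 # u)) t3 +
     trie_sum (\<lambda>u. f (p4 # u)) t4 + trie_sum (\<lambda>u. f (p5 # u)) t5 + trie_sum (\<lambda>u. f (p6 # u)) t6"
| "trie_sum f (Mix s t) = trie_sum f s + trie_sum f t"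

lemma trie_sum_single: "trie_sum f (single_trie u c) = scale (of_int c) (f u)"
  by (induction u c arbitrary: f rule: single_trie.induct) simp_all

lemma trie_sum_add: "trie_sum f (add_trie s t) = trie_sum f s + trie_sum f t"
  by (induction s t arbitrary: f rule: add_trie.induct)
    (simp_all add: scale_left_distrib add.assoc add.left_commute)

lemma trie_sum_zero: "zero_trie t \<Longrightarrow> trie_sum f t = 0"
  by (induction t arbitrary: f) simp_all

lemma sum_list_trie_words: "(\<Sum>(c, u) \<leftarrow> trie_words t. scale (of_int c) (f u)) = trie_sum f t"
proof (induction t arbitrary: f)
  case (Node t1 t2 t3 t4 t5 t6)
  show ?case
    using Node.IH(1)[of "\<lambda>u. f (p1 # u)"] Node.IH(2)[of "\<lambda>u. f (p2 # u)"]
      Node.IH(3)[of "\<lambda>u. f (p3 # u)"] Node.IH(4)[of "\<lambda>u. f (p4 # u)"]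
      Node.IH(5)[of "\<lambda>u. f (p5 # u)"] Node.IH(6)[of "\<lambda>u. f (p6 # u)"]
    by (simp add: comp_def case_prod_unfold add.assoc)
qed simp_all

definition form_sum :: "(pos \<Rightarrow> pos list \<Rightarrow> 'b) \<Rightarrow> form \<Rightarrow> 'b" where
  "form_sum f b = (\<Sum>(c, t, u) \<leftarrow> b. scale (of_int c) (f t u))"

lemma form_sum_simps:
  "form_sum f [] = 0"
  "form_sum f ((c, t, u) # b) = scale (of_int c) (f t u) + form_sum f b"
  by (simp_all add: form_sum_def)

lemma form_sum_append: "form_sum f (a @ b) = form_sum f a + form_sum f b"
  by (simp add: form_sum_def)

lemma form_sum_cong:
  assumes "\<And>c t u. (c, t, u) \<in> set b \<Longrightarrow> f t u = g t u"
  shows "form_sum f b = form_sum g b"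
  unfolding form_sum_def using assms by (intro arg_cong[where f = sum_list] map_cong) auto

lemma trie_sum_form_trie:
  "trie_sum (\<lambda>x. f (hd x) (tl x)) (form_trie g k b) =
    scale (of_int k) (form_sum (\<lambda>t u. f t (map (letter g) u)) b)"
  by (induction g k b rule: form_trie.induct)
    (simp_all add: form_sum_simps trie_sum_add trie_sum_single scale_right_distrib)

lemma form_sum_normalize: "form_sum f (normalize b) = form_sum f b"
proof -
  have "form_sum f (normalize b) =
      (\<Sum>(c, u) \<leftarrow> trie_words (form_trie [p1, p2, p3, p4, p5, p6] 1 b). scale (of_int c) (f (hd u) (tl u)))"
    by (simp add: form_sum_def normalize_def comp_def case_prod_unfold)
  also have "\<dots> = form_sum f b"
    by (simp only: sum_list_trie_words trie_sum_form_trie map_letter_id) simp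
  finally show ?thesis .
qed

definition comb_sum :: "(pos list \<Rightarrow> 'b) \<Rightarrow> pos list list list \<Rightarrow> int list list \<Rightarrow> 'b" where
  "comb_sum h rs kss = (\<Sum>(r, ks) \<leftarrow> zip rs kss. \<Sum>(g, k) \<leftarrow> zip r ks. scale (of_int k) (h g))"

lemma trie_sum_row_trie:
  "trie_sum (\<lambda>x. f (hd x) (tl x)) (row_trie h s b r ks) = scale (of_int s)
    (\<Sum>(g, k) \<leftarrow> zip r ks. scale (of_int k) (form_sum (\<lambda>t u. f t (map (letter (map (letter h) g)) u)) b))"
  by (induction h s b r ks rule: row_trie.induct)
    (simp_all add: trie_sum_add trie_sum_form_trie scale_right_distrib)

lemma trie_sum_comb_trie:
  "trie_sum (\<lambda>x. f (hd x) (tl x)) (comb_trie h s b rs kss) = scale (of_int s)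
    (comb_sum (\<lambda>g. form_sum (\<lambda>t u. f t (map (letter (map (letter h) g)) u)) b) rs kss)"
  by (induction h s b rs kss rule: comb_trie.induct)
    (simp_all add: comb_sum_def trie_sum_add trie_sum_row_trie scale_right_distrib)

lemma comb_sum_cong:
  assumes "\<And>r g. r \<in> set rs \<Longrightarrow> g \<in> set r \<Longrightarrow> f g = h g"
  shows "comb_sum f rs kss = comb_sum h rs kss"
  unfolding comb_sum_def using assms
  by (auto intro!: arg_cong[where f = sum_list] map_cong dest!: set_zip_leftD)

lemma comb_sum_0: "comb_sum (\<lambda>_. 0) rs kss = 0"
  by (simp add: comb_sum_def case_prod_unfold)

definition data_sum :: "(pos \<Rightarrow> nat list \<Rightarrow> 'b) \<Rightarrow> nat list \<Rightarrow>
    combination \<Rightarrow> 'b" where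
  "data_sum f w l = (\<Sum>(b, rs, kss) \<leftarrow> l.
     comb_sum (\<lambda>g. form_sum (\<lambda>t u. f t (map (letter (map (letter w) g)) u)) b) rs kss)"

lemma data_sum_simps:
  "data_sum f w [] = 0"
  "data_sum f w ((b, rs, kss) # l) =
     comb_sum (\<lambda>g. form_sum (\<lambda>t u. f t (map (letter (map (letter w) g)) u)) b) rs kss + data_sum f w l"
  by (simp_all add: data_sum_def)

text \<open>Substituting the positions \<open>h\<close> and then the letters \<open>w\<close>
  amounts to substituting \<open>map (letter w) h\<close> at once. The range conditions enter
  because \<open>letter\<close> is a list access and composes correctly only inside the
  list.\<close>

lemma trie_sum_data_trie:
  assumes "data_below n l" "n \<le> length h"
  shows "trie_sum (\<lambda>x. f (hd x) (map (letter w) (tl x))) (data_trie h s l) =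
    scale (of_int s) (data_sum f (map (letter w) h) l)"
  using assms(1)
proof (induction l)
  case (Cons d l)
  obtain b rs kss where d: "d = (b, rs, kss)" by (cases d)
  have below: "form_below n b" "permutations_below n rs" "data_below n l"
    using Cons.prems by (auto simp: data_below_def d)
  have "comb_sum (\<lambda>g. form_sum (\<lambda>t u. f t (map (letter w) (map (letter (map (letter h) g)) u))) b) rs kss =
    comb_sum (\<lambda>g. form_sum (\<lambda>t u. f t (map (letter (map (letter (map (letter w) h)) g)) u)) b) rs kss"
  proof (intro comb_sum_cong form_sum_cong)
    fix r g c t u assume "r \<in> set rs" "g \<in> set r" "(c, t, u) \<in> set b"
    then have g: "length g = n" "positions_below n g" and u: "positions_below n u"
      using below by (auto simp: permutations_below_def form_below_def)
    have "map (letter w) (map (letter (map (letter h) g)) u) =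
        map (letter (map (letter w) (map (letter h) g))) u"
      using u g by (intro map_letter_map_letter) (auto simp: positions_below_def)
    also have "map (letter w) (map (letter h) g) = map (letter (map (letter w) h)) g"
      using g assms(2) by (intro map_letter_map_letter) (auto simp: positions_below_def)
    finally show "f t (map (letter w) (map (letter (map (letter h) g)) u)) =
      f t (map (letter (map (letter (map (letter w) h)) g)) u)" by (rule arg_cong)
  qed
  then show ?case
    using Cons.IH[OF below(3)]
      trie_sum_comb_trie[of "\<lambda>t u. f t (map (letter w) u)" h s b rs kss]
    by (simp add: d trie_sum_add data_sum_simps scale_right_distrib)
qed (simp add: data_sum_simps)

lemma trie_sum_subst_trie:
  assumes "data_below n l" "\<forall>(c, t, u) \<in> set b. n \<le> length u"
  shows "trie_sum (\<lambda>x. f (hd x) (map (letter w) (tl x))) (subst_trie l b) =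
    form_sum (\<lambda>t u. data_sum f (map (letter w) u) l) b"
  using assms(2)
  by (induction b) (auto simp: form_sum_simps trie_sum_add trie_sum_data_trie[OF assms(1)])

text \<open>Each entry permutes positions and so turns \<open>w\<close> into another word of
  distinct letters. A relation that vanishes on all such words vanishes in every permuted
  copy.\<close>

lemma data_sum_null:
  assumes null: "\<And>b rs kss z. (b, rs, kss) \<in> set l \<Longrightarrow> distinct (i # z) \<Longrightarrow> length z = n \<Longrightarrow>
      form_sum (\<lambda>t u. f t (map (letter z) u)) b = 0"
    and "data_below n l" "distinct (i # w)" "length w = n"
  shows "data_sum f w l = 0"
proof -
  have "comb_sum (\<lambda>g. form_sum (\<lambda>t u. f t (map (letter (map (letter w) g)) u)) b) rs kss = comb_sum (\<lambda>_. 0) rs kss"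
    if l: "(b, rs, kss) \<in> set l" for b rs kss
  proof (intro comb_sum_cong null[OF l])
    fix r g assume "r \<in> set rs" "g \<in> set r"
    then have g: "length g = n" "distinct g" "positions_below n g"
      using assms(2) l by (auto simp: data_below_def permutations_below_def)
    show "length (map (letter w) g) = n" using g by simp
    have "set (map (letter w) g) \<subseteq> set w"
      using g assms(4) by (auto simp: positions_below_def letter_def)
    moreover have "distinct (map (letter w) g)"
      using g assms by (intro distinct_map_letter) auto
    ultimately show "distinct (i # map (letter w) g)" using assms(3) by auto
  qed
  then show ?thesis
    unfolding data_sum_def
    by (intro sum_list_0 [THEN trans[rotated]] arg_cong[where f = sum_list])
      (auto simp: comb_sum_0 intro!: map_cong)
qed

lemma trie_sum_data_trie_id:
  assumes "data_below n l" "n \<le> 6"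
  shows "trie_sum (\<lambda>x. f (hd x) (map (letter w) (tl x))) (data_trie [p1, p2, p3, p4, p5, p6] s l) =
    scale (of_int s) (data_sum f w l)"
proof -
  \<comment> \<open>For a word of fewer than six letters the two lists differ. The access functions
    still agree, and \<open>data_sum\<close> uses \<open>w\<close> only through
    \<open>letter w\<close>.\<close>
  have "letter (map (letter w) [p1, p2, p3, p4, p5, p6]) = letter w"
  proof
    fix p show "letter (map (letter w) [p1, p2, p3, p4, p5, p6]) p = letter w p"
      by (cases p) (simp_all add: letter_simps)
  qed
  then show ?thesis
    using trie_sum_data_trie[of n l "[p1, p2, p3, p4, p5, p6]" f w s] assms
    by (simp only: data_sum_def) simp
qed

text \<open>The formal identity reads theta(product of b) - d b + rel = 0. Evaluation by any
  \<open>f\<close> that annihilates the relations leaves theta(product of b) = d b, and d is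
  invertible.\<close>

theorem certificate:
  assumes zero: "zero_trie (add_trie (subst_trie l b)
      (add_trie (form_trie [p1, p2, p3, p4, p5, p6] (- d) b)
        (data_trie [p1, p2, p3, p4, p5, p6] 1 rel)))"
    and null: "\<And>b rs kss z. (b, rs, kss) \<in> set rel \<Longrightarrow> distinct (i # z) \<Longrightarrow> length z = n \<Longrightarrow>
      form_sum (\<lambda>t u. f t (map (letter z) u)) b = 0"
    and l: "data_below n l" and b: "\<forall>(c, t, u) \<in> set b. n \<le> length u" and rel: "data_below n rel"
    and w: "distinct (i # w)" "length w = n" and n: "n \<le> 6" and d: "of_int d \<noteq> (0 :: 'a)"
  shows "form_sum (\<lambda>t u. scale (inverse (of_int d)) (data_sum f (map (letter w) u) l) -
    f t (map (letter w) u)) b = 0"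
proof -
  let ?f = "\<lambda>x. f (hd x) (map (letter w) (tl x))"
  have "form_sum (\<lambda>t u. data_sum f (map (letter w) u) l) b +
      scale (of_int (- d)) (form_sum (\<lambda>t u. f t (map (letter w) u)) b) = 0"
    using trie_sum_zero[OF zero, of ?f] data_sum_null[OF null rel w]
      trie_sum_form_trie[of "\<lambda>t u. f t (map (letter w) u)" "[p1, p2, p3, p4, p5, p6]" "- d" b]
    by (simp only: trie_sum_add trie_sum_subst_trie[OF l b] trie_sum_data_trie_id[OF rel n]
        map_letter_id scale_zero_right add_0_right)
  then have "form_sum (\<lambda>t u. data_sum f (map (letter w) u) l) b =
      scale (of_int d) (form_sum (\<lambda>t u. f t (map (letter w) u)) b)"
    by simp
  moreover have "form_sum (\<lambda>t u. scale c (g t u) - h t u) b = scale c (form_sum g b) - form_sum h b" for c g h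
    by (induction b) (auto simp: form_sum_simps scale_right_distrib scale_right_diff_distrib mult.commute)
  ultimately show ?thesis using d by simp
qed

end

section \<open>Factorization through the free associative algebra\<close>

fun rename :: "(nat \<Rightarrow> nat) \<Rightarrow> tmonomial \<Rightarrow> tmonomial" where
  "rename h (Var i) = Var (h i)"
| "rename h \<langle>x y z\<rangle> = \<langle>(rename h x) (rename h y) (rename h z)\<rangle>"

lemma vars_rename: "vars (rename h m) = map h (vars m)"
  by (induction m) simp_all

lemma W_rename: "W (rename h m) f = W m (\<lambda>p. f (map h p))"
  by (induction m arbitrary: f) simp_all

lemma eval_monomial_rename: "eval_monomial tri v (rename h m) = eval_monomial tri (\<lambda>i. v (h i)) m"
  by (induction m) simp_all

definition commutator_terms ::
    "tmonomial \<Rightarrow> tmonomial \<Rightarrow> tmonomial \<Rightarrow> tmonomial \<Rightarrow> (int \<times> tmonomial \<times> tmonomial) list" where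
  "commutator_terms p q r s =
     [(1, \<langle>p r s\<rangle>, q), (1, p, \<langle>q r s\<rangle>), (1, \<langle>r p q\<rangle>, s), (1, r, \<langle>s p q\<rangle>)]"

lemma pos_index_pos_of: "n < 6 \<Longrightarrow> pos_index (pos_of n) = n"
  by (auto simp: pos_of_def less_Suc_eq numeral_eq_Suc)

context jacobi_derivation_algebra
begin

lemma sum_list_tensor:
  "(\<Sum>(a, p) \<leftarrow> tensor l m. scale (of_int a) (f p)) =
    (\<Sum>(a, p) \<leftarrow> l. scale (of_int a) (\<Sum>(b, q) \<leftarrow> m. scale (of_int b) (f (p @ q))))"
proof -
  have "(\<Sum>(b, q) \<leftarrow> m. scale (of_int (a * b)) (f (p @ q))) =
      scale (of_int a) (\<Sum>(b, q) \<leftarrow> m. scale (of_int b) (f (p @ q)))" for a p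
    by (induction m) (auto simp: scale_right_distrib)
  then show ?thesis
    by (induction l) (auto simp: tensor_def comp_def case_prod_unfold)
qed

lemma sum_list_expand:
  "(\<Sum>(a, p) \<leftarrow> expand m. scale (of_int a) (f p)) = W m (\<lambda>p. f (map pos_of p))"
proof (induction m arbitrary: f)
  case (Tri x y z)
  have minus: "(\<Sum>(a, p) \<leftarrow> map (\<lambda>(a, p). (- a, p)) l. scale (of_int a) (f p)) =
      - (\<Sum>(a, p) \<leftarrow> l. scale (of_int a) (f p))" for l :: "(int \<times> pos list) list" and f :: "pos list \<Rightarrow> 'b"
    by (induction l) auto
  have "W y (\<lambda>q. W z (\<lambda>r. W x (\<lambda>p. f (map pos_of (q @ r @ p))))) =
      W x (\<lambda>p. W y (\<lambda>q. W z (\<lambda>r. f (map pos_of (q @ r @ p)))))"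
    by (rule W_rotate)
  then show ?case
    by (simp add: minus sum_list_tensor Tri.IH del: map_map)
qed simp

lemma form_sum_pair_form:
  "form_sum f (pair_form l) = (\<Sum>(c, y, z) \<leftarrow> l. scale (of_int c)
    (W y (\<lambda>p. W z (\<lambda>r. f (pos_of (length p - 1)) (map pos_of (p @ r))))))"
proof (induction l rule: pair_form.induct)
  case (2 c y z l)
  have "form_sum f (concat (map (\<lambda>(a, p). map (\<lambda>(b, q). (c * (a * b), split_pos p, p @ q)) s) s')) =
      scale (of_int c) (\<Sum>(a, p) \<leftarrow> s'. scale (of_int a)
        (\<Sum>(b, q) \<leftarrow> s. scale (of_int b) (f (split_pos p) (p @ q))))" for s s'
  proof (induction s')
    case (Cons ap s')
    have "form_sum f (map (\<lambda>(b, q). (c * (fst ap * b), split_pos (snd ap), snd ap @ q)) s) =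
        scale (of_int (c * fst ap))
          (\<Sum>(b, q) \<leftarrow> s. scale (of_int b) (f (split_pos (snd ap)) (snd ap @ q)))"
      by (induction s) (auto simp: form_sum_simps scale_right_distrib mult.assoc)
    then show ?case using Cons
      by (simp add: form_sum_append scale_right_distrib case_prod_unfold)
  qed (simp add: form_sum_simps)
  then show ?case
    using 2 by (simp add: form_sum_append sum_list_expand split_pos_def)
qed (simp add: form_sum_simps)

definition term_in_range :: "nat \<Rightarrow> tmonomial \<Rightarrow> tmonomial \<Rightarrow> bool" where
  "term_in_range n y z \<longleftrightarrow>
     distinct (vars y @ vars z) \<and> set (vars y @ vars z) \<subseteq> {..<n} \<and> n \<le> 6"

text \<open>Passes from a generic pair, written in positions and fit for computation, to the pair in
  the actual variables listed by \<open>w\<close>.\<close>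

lemma W_pos:
  assumes "term_in_range (length w) y z"
  shows "W y (\<lambda>p. W z (\<lambda>r. g (Suc (pos_index (pos_of (length p - 1)))) (map (letter w) (map pos_of (p @ r))))) =
    W (rename ((!) w) y) (\<lambda>p. W (rename ((!) w) z) (\<lambda>r. g (length p) (p @ r)))"
  unfolding W_rename
proof (intro W_cong)
  fix p r assume p: "mset p = mset (vars y)" and r: "mset r = mset (vars z)"
  have set: "set p = set (vars y)" "set r = set (vars z)"
    using p r by (metis set_mset_mset)+
  have map: "map (letter w) (map pos_of (p @ r)) = map ((!) w) p @ map ((!) w) r"
    using assms set by (auto simp: term_in_range_def letter_pos_of)
  have "0 < length p" using p length_vars[of y] by (cases p) auto
  moreover have "length p \<le> 6"
  proof -
    have "length p = card (set p)"
      using assms p set by (metis distinct_append distinct_card size_mset term_in_range_def)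
    also have "\<dots> \<le> card {..<length w}"
      using assms set by (intro card_mono) (auto simp: term_in_range_def)
    finally show ?thesis using assms by (simp add: term_in_range_def)
  qed
  \<comment> \<open>Positive length makes the truncated subtraction exact; length at most 6 keeps
    \<open>pos_of\<close> off its default value.\<close>
  ultimately have "Suc (pos_index (pos_of (length p - 1))) = length p"
    by (simp add: pos_index_pos_of)
  with map show "g (Suc (pos_index (pos_of (length p - 1)))) (map (letter w) (map pos_of (p @ r))) =
      g (length (map ((!) w) p)) (map ((!) w) p @ map ((!) w) r)"
    by (simp only: length_map)
qed

text \<open>Words of different lengths never share an expansion, so a single \<open>\<psi>\<close>
  can cover all degrees up to n and be enlarged degree by degree.\<close>

definition factors :: "(nat \<Rightarrow> 'b) \<Rightarrow> nat \<Rightarrow> (nat list \<Rightarrow> 'b) \<Rightarrow> bool" where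
  "factors v n \<psi> \<longleftrightarrow>
     (\<forall>m. distinct (vars m) \<and> length (vars m) \<le> n \<longrightarrow> eval_monomial tri v m = W m \<psi>)"

text \<open>The value at \<open>v i\<close> of D_PR, read on words: \<open>\<psi>\<close> of the two
  pieces of \<open>w\<close> takes the place of P and R.\<close>

definition split_value :: "(nat \<Rightarrow> 'b) \<Rightarrow> (nat list \<Rightarrow> 'b) \<Rightarrow> nat \<Rightarrow> nat \<Rightarrow> nat list \<Rightarrow> 'b" where
  "split_value v \<psi> i k w = tri (v i) (\<psi> (take k w)) (\<psi> (drop k w))"

lemma tri_eval_monomial:
  assumes "factors v n \<psi>" "distinct (vars y @ vars z)" "length (vars y) \<le> n" "length (vars z) \<le> n"
  shows "tri (v i) (eval_monomial tri v y) (eval_monomial tri v z) =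
    W y (\<lambda>p. W z (\<lambda>r. split_value v \<psi> i (length p) (p @ r)))"
  using assms W_swap[of y z "\<lambda>p r. tri (v i) (\<psi> p) (\<psi> r)"]
  by (simp add: factors_def tri_W_2 tri_W_3 split_value_def)

lemma form_sum_split_value:
  assumes "factors v n \<psi>" "distinct w"
    and "\<forall>(c, y, z) \<in> set l. term_in_range (length w) y z \<and> length (vars y) \<le> n \<and> length (vars z) \<le> n"
  shows "form_sum (\<lambda>t u. split_value v \<psi> i (Suc (pos_index t)) (map (letter w) u)) (pair_form l) =
    (\<Sum>(c, y, z) \<leftarrow> l. scale (of_int c)
      (tri (v i) (eval_monomial tri (\<lambda>j. v (w ! j)) y) (eval_monomial tri (\<lambda>j. v (w ! j)) z)))"
  unfolding form_sum_pair_form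
proof (intro arg_cong[where f = sum_list] map_cong refl)
  fix cyz assume "cyz \<in> set l"
  moreover obtain c y z where cyz: "cyz = (c, y, z)" by (cases cyz)
  ultimately have "(c, y, z) \<in> set l" by simp
  then have yz: "term_in_range (length w) y z" "length (vars y) \<le> n" "length (vars z) \<le> n"
    using assms(3) by auto
  then have "distinct (map ((!) w) (vars y @ vars z))"
    unfolding distinct_map using inj_on_nth[OF assms(2), of "set (vars y @ vars z)"]
    by (auto simp: term_in_range_def)
  then have "tri (v i) (eval_monomial tri v (rename ((!) w) y)) (eval_monomial tri v (rename ((!) w) z)) =
      W (rename ((!) w) y) (\<lambda>p. W (rename ((!) w) z) (\<lambda>r. split_value v \<psi> i (length p) (p @ r)))"
    using yz by (intro tri_eval_monomial[OF assms(1)]) (simp_all add: vars_rename)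
  then show "(case cyz of (c, y, z) \<Rightarrow> scale (of_int c) (W y (\<lambda>p. W z (\<lambda>r.
      split_value v \<psi> i (Suc (pos_index (pos_of (length p - 1)))) (map (letter w) (map pos_of (p @ r))))))) =
    (case cyz of (c, y, z) \<Rightarrow> scale (of_int c) (tri (v i) (eval_monomial tri (\<lambda>j. v (w ! j)) y)
      (eval_monomial tri (\<lambda>j. v (w ! j)) z)))"
    by (simp only: cyz prod.case W_pos[OF yz(1), of "split_value v \<psi> i"] eval_monomial_rename)
qed

text \<open>The assumption says that \<open>\<theta>\<close>, which sees only the product word,
  agrees with \<open>split_value\<close>, which sees the split, on the expansions of every pair.
  Both factors have odd degree, hence degree at most n, so \<open>\<psi>\<close> already computes
  them.\<close>

lemma factors_extend:
  assumes \<psi>: "factors v n \<psi>" and n: "odd n"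
    and \<theta>: "\<And>i y z. distinct (vars \<langle>(Var i) y z\<rangle>) \<Longrightarrow> length (vars y @ vars z) = Suc n \<Longrightarrow>
      W y (\<lambda>p. W z (\<lambda>r. \<theta> i (p @ r) - split_value v \<psi> i (length p) (p @ r))) = 0"
  shows "\<exists>\<psi>'. factors v (n + 2) \<psi>'"
proof -
  define \<psi>' where "\<psi>' = (\<lambda>w. if length w \<le> n then \<psi> w else word_potential \<theta> w)"
  have "eval_monomial tri v m = W m \<psi>'" if m: "distinct (vars m)" "length (vars m) \<le> n + 2" for m
  proof (cases "length (vars m) \<le> n")
    case True
    have "W m \<psi>' = W m \<psi>" using True by (intro W_cong) (auto simp: \<psi>'_def dest: mset_eq_length)
    then show ?thesis using \<psi> m True by (simp add: factors_def)
  next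
    case False
    \<comment> \<open>Degree n + 1 is even and contains no monomial, so n + 2 is the only new
      degree.\<close>
    have "length (vars m) \<noteq> n + 1" using n length_vars[of m] by auto
    then have len: "length (vars m) = n + 2" using False m by simp
    have "eval_monomial tri v m = W m (word_potential \<theta>)"
    proof (rule word_potential_correct[OF _ m(1) len])
      fix i y z
      assume yz: "distinct (vars \<langle>(Var i) y z\<rangle>)" "length (vars \<langle>(Var i) y z\<rangle>) = n + 2"
      then have "length (vars y) \<le> n" "length (vars z) \<le> n"
        using length_vars[of y] length_vars[of z] by (auto elim!: oddE)
      then have "tri (v i) (eval_monomial tri v y) (eval_monomial tri v z) =
          W y (\<lambda>p. W z (\<lambda>r. split_value v \<psi> i (length p) (p @ r)))"
        using yz by (intro tri_eval_monomial[OF \<psi>]) auto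
      then show "tri (v i) (eval_monomial tri v y) (eval_monomial tri v z) =
          W y (\<lambda>p. W z (\<lambda>r. \<theta> i (p @ r)))"
        using \<theta>[of i y z] yz by (simp add: W_diff)
    qed (use n in auto)
    also have "\<dots> = W m \<psi>'"
      using len by (intro W_cong) (auto simp: \<psi>'_def dest: mset_eq_length)
    finally show ?thesis .
  qed
  then show ?thesis unfolding factors_def by blast
qed

lemma factors_3: "\<exists>\<psi>. factors v 3 \<psi>"
proof -
  let ?\<psi> = "\<lambda>w. v (hd w)"
  have 1: "factors v 1 ?\<psi>"
    unfolding factors_def
  proof (intro allI impI)
    fix m assume "distinct (vars m) \<and> length (vars m) \<le> 1"
    then have "length (vars m) = 1" using length_vars[of m] by (cases "length (vars m)") auto
    then show "eval_monomial tri v m = W m ?\<psi>" using length_vars_eq_1[of m] by auto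
  qed
  have "\<exists>\<psi>'. factors v (1 + 2) \<psi>'"
  \<comment> \<open>The only split of a two-letter word is after its first letter, so
    \<open>split_value\<close> at 1 already depends on the word alone.\<close>
  proof (rule factors_extend[OF 1, where \<theta> = "\<lambda>i. split_value v ?\<psi> i 1"])
    fix y z assume "length (vars y @ vars z) = Suc 1"
    then have "length (vars y) = 1" "length (vars z) = 1"
      using length_vars[of y] length_vars[of z] by (auto elim!: oddE)
    then obtain a b where "y = Var a" "z = Var b"
      using length_vars_eq_1 by metis
    then show "W y (\<lambda>p. W z (\<lambda>r. split_value v ?\<psi> i 1 (p @ r) -
        split_value v ?\<psi> i (length p) (p @ r))) = 0" for i
      by simp
  qed simp
  then show ?thesis by (simp add: numeral_eq_Suc)
qed

lemma form_sum_commutator_terms: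
  assumes "factors v n \<psi>" "distinct w"
    and "\<forall>(c, y, z) \<in> set (commutator_terms p q r s).
      term_in_range (length w) y z \<and> length (vars y) \<le> n \<and> length (vars z) \<le> n"
  shows "form_sum (\<lambda>t u. split_value v \<psi> i (Suc (pos_index t)) (map (letter w) u))
    (pair_form (commutator_terms p q r s)) = 0"
  unfolding form_sum_split_value[OF assms]
  by (simp add: commutator_terms_def add.assoc[symmetric] tri_commutator)

end

section \<open>The certificates in degrees 5 and 7\<close>

definition gen13 :: form where
  "gen13 = pair_form [(1, Var 0, \<langle>(Var 1) (Var 2) (Var 3)\<rangle>)]"

definition gen31 :: form where
  "gen31 = pair_form [(1, \<langle>(Var 0) (Var 1) (Var 2)\<rangle>, Var 3)]"

definition gen33 :: form where
  "gen33 = pair_form [(1, \<langle>(Var 0) (Var 1) (Var 2)\<rangle>, \<langle>(Var 3) (Var 4) (Var 5)\<rangle>)]"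

text \<open>For a factor of degree 5 two shapes suffice, here and for the pairs of degrees 5 and 1:
  \<open>W\<close> obeys (1) and (2), so its first entry can be made a variable, and the triple
  product is then in third or second place.\<close>

definition gen15a :: form where
  "gen15a = pair_form [(1, Var 0, \<langle>(Var 1) (Var 2) \<langle>(Var 3) (Var 4) (Var 5)\<rangle>\<rangle>)]"

definition gen15b :: form where
  "gen15b = pair_form [(1, Var 0, \<langle>(Var 1) \<langle>(Var 2) (Var 3) (Var 4)\<rangle> (Var 5)\<rangle>)]"

definition gen51a :: form where
  "gen51a = pair_form [(1, \<langle>(Var 0) (Var 1) \<langle>(Var 2) (Var 3) (Var 4)\<rangle>\<rangle>, Var 5)]"

definition gen51b :: form where
  "gen51b = pair_form [(1, \<langle>(Var 0) \<langle>(Var 1) (Var 2) (Var 3)\<rangle> (Var 4)\<rangle>, Var 5)]"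

definition comm1111 :: form where
  "comm1111 = pair_form (commutator_terms (Var 0) (Var 1) (Var 2) (Var 3))"

text \<open>The commutator relation is unchanged when (p,q) and (r,s) are exchanged, so the entry of
  degree 3 may be taken as p or as q. This gives \<open>comm3111\<close> and
  \<open>comm1311\<close>.\<close>

definition comm3111 :: form where
  "comm3111 = pair_form (commutator_terms \<langle>(Var 0) (Var 1) (Var 2)\<rangle> (Var 3) (Var 4) (Var 5))"

text \<open>The last two arguments are \<open>Var 5\<close>, \<open>Var 4\<close> in this order so
  that all words are even rearrangements of the positions, as for the other generators and
  relations.\<close>

definition comm1311 :: form where
  "comm1311 = pair_form (commutator_terms (Var 3) \<langle>(Var 0) (Var 1) (Var 2)\<rangle> (Var 5) (Var 4))"

text \<open>All 45 terms have the form (a,y,z). Only the pairs y, z are kept, with b to g renumbered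
  from 0 to fit the six positions.\<close>

definition identity_45_terms :: "(int \<times> tmonomial \<times> tmonomial) list" where
  "identity_45_terms =
     (let b = Var 0; c = Var 1; d = Var 2; e = Var 3; f = Var 4; g = Var 5 in
      [(1, b, \<langle>c d \<langle>e f g\<rangle>\<rangle>), (- 1, b, \<langle>c f \<langle>d e g\<rangle>\<rangle>), (- 1, b, \<langle>c f \<langle>e g d\<rangle>\<rangle>),
       (- 1, b, \<langle>c e \<langle>d g f\<rangle>\<rangle>), (- 1, b, \<langle>c g \<langle>f e d\<rangle>\<rangle>), (- 1, b, \<langle>d c \<langle>f e g\<rangle>\<rangle>),
       (1, b, \<langle>d f \<langle>c g e\<rangle>\<rangle>), (1, b, \<langle>d e \<langle>c f g\<rangle>\<rangle>), (1, b, \<langle>d e \<langle>f g c\<rangle>\<rangle>),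
       (- 1, b, \<langle>f c \<langle>d g e\<rangle>\<rangle>), (- 1, b, \<langle>f c \<langle>e d g\<rangle>\<rangle>), (- 1, b, \<langle>f d \<langle>e g c\<rangle>\<rangle>),
       (1, b, \<langle>f g \<langle>d e c\<rangle>\<rangle>), (1, b, \<langle>e c \<langle>f g d\<rangle>\<rangle>), (1, b, \<langle>e d \<langle>c g f\<rangle>\<rangle>),
       (1, b, \<langle>e d \<langle>f c g\<rangle>\<rangle>), (- 1, b, \<langle>e g \<langle>c f d\<rangle>\<rangle>), (- 1, b, \<langle>e g \<langle>d c f\<rangle>\<rangle>),
       (1, b, \<langle>g f \<langle>d c e\<rangle>\<rangle>), (- 1, b, \<langle>g e \<langle>c d f\<rangle>\<rangle>), (1, c, \<langle>f b \<langle>d e g\<rangle>\<rangle>),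
       (- 1, c, \<langle>g b \<langle>d f e\<rangle>\<rangle>), (- 1, c, \<langle>g b \<langle>f e d\<rangle>\<rangle>), (- 1, d, \<langle>e b \<langle>c f g\<rangle>\<rangle>),
       (- 1, d, \<langle>g b \<langle>f c e\<rangle>\<rangle>), (- 1, g, \<langle>d b \<langle>c f e\<rangle>\<rangle>), (- 1, g, \<langle>d b \<langle>f e c\<rangle>\<rangle>),
       (1, g, \<langle>f b \<langle>c e d\<rangle>\<rangle>), (- 1, \<langle>b c d\<rangle>, \<langle>e f g\<rangle>), (1, \<langle>b c f\<rangle>, \<langle>d e g\<rangle>),
       (- 1, \<langle>b c g\<rangle>, \<langle>d f e\<rangle>), (- 1, \<langle>b d e\<rangle>, \<langle>c f g\<rangle>), (- 1, \<langle>b d g\<rangle>, \<langle>f c e\<rangle>),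
       (1, \<langle>b e g\<rangle>, \<langle>d c f\<rangle>), (- 1, \<langle>b g d\<rangle>, \<langle>c f e\<rangle>), (- 1, \<langle>b g d\<rangle>, \<langle>f e c\<rangle>),
       (1, \<langle>b g f\<rangle>, \<langle>c e d\<rangle>), (- 1, \<langle>c b d\<rangle>, \<langle>f e g\<rangle>), (1, \<langle>c b e\<rangle>, \<langle>d f g\<rangle>),
       (1, \<langle>c b e\<rangle>, \<langle>f g d\<rangle>), (- 1, \<langle>c d b\<rangle>, \<langle>e f g\<rangle>), (1, \<langle>c g b\<rangle>, \<langle>f e d\<rangle>),
       (- 1, \<langle>d b f\<rangle>, \<langle>c e g\<rangle>), (- 1, \<langle>d b f\<rangle>, \<langle>e g c\<rangle>), (1, \<langle>e g b\<rangle>, \<langle>d c f\<rangle>)])"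

text \<open>The expansion produces 180 signed words. Collecting equal ones once pays off because
  each degree 7 certificate inserts 35 permuted copies.\<close>

definition rel45 :: form where
  "rel45 = normalize (pair_form identity_45_terms)"

text \<open>The certificates were found by linear algebra. Read as an operator on words, \<open>theta4 / 12\<close> is the
  projection \<open>1 - (\<Sum>g. g) / 12\<close> with \<open>g\<close> ranging over the alternating group on four positions.\<close>

definition perms_gen13 :: "pos list list list" where
  "perms_gen13 =
  [[[p1,p2,p3,p4], [p1,p3,p4,p2], [p2,p1,p4,p3], [p2,p3,p1,p4],
    [p3,p1,p2,p4], [p3,p2,p4,p1], [p4,p1,p3,p2], [p4,p2,p1,p3]]]"

definition perms_gen31 :: "pos list list list" where
  "perms_gen31 =
  [[[p1,p2,p3,p4], [p1,p3,p4,p2], [p1,p4,p2,p3]]]"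

definition theta4 :: combination where
  "theta4 = [(gen13, perms_gen13,
  [[8, 4, 1, 2, -1, -2, 1, 2]]),
  (gen31, perms_gen31,
  [[3, 3, 3]])]"

definition perms_comm1111 :: "pos list list list" where
  "perms_comm1111 =
  [[[p1,p2,p3,p4], [p1,p4,p2,p3], [p2,p1,p4,p3]]]"

text \<open>No relation enters: \<open>gen13\<close> compares a word with the rotation of its last
  three letters. The \<open>gen31\<close> part of \<open>theta4\<close> is invariant under this
  rotation and cancels; the \<open>gen13\<close> part gives exactly 12 times
  \<open>gen13\<close>.\<close>

definition cert_gen13 :: combination where
  "cert_gen13 = []"

definition cert_gen31 :: combination where
  "cert_gen31 = [(comm1111, perms_comm1111,
  [[-3, 6, 3]])]"

text \<open>The words in six letters modulo the products of values of monomials are dual to the functionals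
  \<open>w \<mapsto> c + (\<Sum>i<j. b (w ! i) (w ! j))\<close> with \<open>b\<close> antisymmetric, taken separately on even and odd words.
  Accordingly \<open>theta6 / 360\<close> acts on words as \<open>1 - (\<Sum>g. (1 / 360 + \<epsilon> g / 24) * g)\<close>, where \<open>g\<close> ranges over the
  alternating group and \<open>\<epsilon> g\<close> is the sign of \<open>g 4 - g 3\<close>.\<close>

definition perms_gen33 :: "pos list list list" where
  "perms_gen33 =
  [[[p1,p2,p3,p4,p5,p6], [p1,p2,p3,p5,p6,p4], [p1,p2,p4,p3,p6,p5], [p1,p2,p4,p5,p3,p6],
    [p1,p2,p5,p3,p4,p6], [p1,p2,p5,p4,p6,p3], [p1,p2,p6,p3,p5,p4], [p1,p2,p6,p4,p3,p5],
    [p1,p3,p2,p4,p6,p5], [p1,p3,p2,p5,p4,p6], [p1,p3,p4,p2,p5,p6], [p1,p3,p4,p5,p6,p2]],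
   [[p1,p3,p5,p2,p6,p4], [p1,p3,p5,p4,p2,p6], [p1,p3,p6,p2,p4,p5], [p1,p3,p6,p4,p5,p2],
    [p1,p4,p2,p3,p5,p6], [p1,p4,p2,p5,p6,p3], [p1,p4,p3,p2,p6,p5], [p1,p4,p3,p5,p2,p6],
    [p1,p4,p5,p2,p3,p6], [p1,p4,p5,p3,p6,p2], [p1,p4,p6,p2,p5,p3], [p1,p4,p6,p3,p2,p5]],
   [[p1,p5,p2,p3,p6,p4], [p1,p5,p2,p4,p3,p6], [p1,p5,p3,p2,p4,p6], [p1,p5,p3,p4,p6,p2],
    [p1,p5,p4,p2,p6,p3], [p1,p5,p4,p3,p2,p6], [p1,p5,p6,p2,p3,p4], [p1,p5,p6,p3,p4,p2],
    [p1,p6,p2,p3,p4,p5], [p1,p6,p2,p4,p5,p3], [p1,p6,p3,p2,p5,p4], [p1,p6,p3,p4,p2,p5]],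
   [[p1,p6,p4,p2,p3,p5], [p1,p6,p4,p3,p5,p2], [p1,p6,p5,p2,p4,p3], [p1,p6,p5,p3,p2,p4],
    [p2,p1,p3,p4,p6,p5], [p2,p1,p3,p5,p4,p6], [p2,p1,p4,p3,p5,p6], [p2,p1,p4,p5,p6,p3],
    [p2,p1,p5,p3,p6,p4], [p2,p1,p5,p4,p3,p6], [p2,p3,p1,p4,p5,p6], [p2,p3,p1,p5,p6,p4]],
   [[p2,p3,p4,p1,p6,p5], [p2,p3,p4,p5,p1,p6], [p2,p3,p5,p1,p4,p6], [p2,p3,p5,p4,p6,p1],
    [p2,p4,p1,p5,p3,p6], [p2,p4,p3,p1,p5,p6], [p2,p4,p3,p5,p6,p1], [p2,p4,p5,p1,p6,p3],
    [p2,p4,p5,p3,p1,p6], [p2,p5,p1,p3,p4,p6], [p2,p5,p1,p4,p6,p3], [p2,p5,p3,p1,p6,p4]],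
   [[p2,p5,p3,p4,p1,p6], [p2,p5,p4,p1,p3,p6], [p2,p5,p4,p3,p6,p1], [p2,p6,p1,p4,p3,p5],
    [p2,p6,p3,p1,p4,p5], [p2,p6,p3,p4,p5,p1], [p2,p6,p4,p1,p5,p3], [p2,p6,p4,p3,p1,p5],
    [p3,p1,p4,p2,p6,p5], [p3,p1,p4,p5,p2,p6], [p3,p4,p5,p1,p2,p6], [p3,p5,p4,p1,p6,p2]],
   [[p3,p6,p4,p1,p2,p5]]]"

definition perms_gen15a :: "pos list list list" where
  "perms_gen15a =
  [[[p1,p2,p3,p4,p5,p6], [p1,p2,p3,p5,p6,p4], [p1,p2,p4,p3,p6,p5], [p1,p2,p4,p5,p3,p6],
    [p1,p2,p5,p3,p4,p6], [p1,p2,p5,p4,p6,p3], [p1,p2,p6,p3,p5,p4], [p1,p2,p6,p4,p3,p5],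
    [p1,p3,p2,p4,p6,p5], [p1,p3,p2,p5,p4,p6], [p1,p3,p4,p2,p5,p6], [p1,p3,p4,p5,p6,p2]],
   [[p1,p3,p5,p2,p6,p4], [p1,p3,p5,p4,p2,p6], [p1,p3,p6,p2,p4,p5], [p1,p3,p6,p4,p5,p2],
    [p1,p4,p2,p3,p5,p6], [p1,p4,p2,p5,p6,p3], [p1,p4,p3,p2,p6,p5], [p1,p4,p3,p5,p2,p6],
    [p1,p4,p5,p2,p3,p6], [p1,p4,p5,p3,p6,p2], [p1,p4,p6,p2,p5,p3], [p1,p4,p6,p3,p2,p5]],
   [[p1,p5,p2,p3,p6,p4], [p1,p5,p2,p4,p3,p6], [p1,p5,p3,p2,p4,p6], [p1,p5,p3,p4,p6,p2],
    [p1,p5,p4,p2,p6,p3], [p1,p5,p4,p3,p2,p6], [p1,p5,p6,p2,p3,p4], [p1,p5,p6,p3,p4,p2],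
    [p1,p6,p2,p3,p4,p5], [p1,p6,p2,p4,p5,p3], [p1,p6,p3,p2,p5,p4], [p1,p6,p3,p4,p2,p5]],
   [[p1,p6,p4,p2,p3,p5], [p1,p6,p4,p3,p5,p2], [p1,p6,p5,p2,p4,p3], [p1,p6,p5,p3,p2,p4],
    [p2,p1,p3,p4,p6,p5], [p2,p1,p3,p5,p4,p6], [p2,p1,p4,p3,p5,p6], [p2,p1,p4,p5,p6,p3],
    [p2,p1,p5,p3,p6,p4], [p2,p1,p5,p4,p3,p6], [p2,p1,p6,p3,p4,p5], [p2,p1,p6,p4,p5,p3]],
   [[p2,p3,p1,p4,p5,p6], [p2,p3,p1,p5,p6,p4], [p2,p3,p4,p1,p6,p5], [p2,p3,p4,p5,p1,p6],
    [p2,p3,p5,p1,p4,p6], [p2,p3,p5,p4,p6,p1], [p2,p3,p6,p1,p5,p4], [p2,p3,p6,p4,p1,p5],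
    [p2,p4,p1,p3,p6,p5], [p2,p4,p1,p5,p3,p6], [p2,p4,p3,p1,p5,p6], [p2,p4,p3,p5,p6,p1]],
   [[p2,p4,p5,p1,p6,p3], [p2,p4,p5,p3,p1,p6], [p2,p4,p6,p1,p3,p5], [p2,p4,p6,p3,p5,p1],
    [p2,p5,p1,p3,p4,p6], [p2,p5,p1,p4,p6,p3], [p2,p5,p3,p1,p6,p4], [p2,p5,p3,p4,p1,p6],
    [p2,p5,p4,p1,p3,p6], [p2,p5,p4,p3,p6,p1], [p2,p5,p6,p1,p4,p3], [p2,p5,p6,p3,p1,p4]],
   [[p2,p6,p1,p3,p5,p4], [p2,p6,p1,p4,p3,p5], [p2,p6,p3,p1,p4,p5], [p2,p6,p3,p4,p5,p1],
    [p2,p6,p4,p1,p5,p3], [p2,p6,p4,p3,p1,p5], [p2,p6,p5,p1,p3,p4], [p2,p6,p5,p3,p4,p1],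
    [p3,p1,p2,p4,p5,p6], [p3,p1,p2,p5,p6,p4], [p3,p1,p4,p2,p6,p5], [p3,p1,p4,p5,p2,p6]],
   [[p3,p1,p5,p2,p4,p6], [p3,p1,p5,p4,p6,p2], [p3,p1,p6,p2,p5,p4], [p3,p1,p6,p4,p2,p5],
    [p3,p2,p1,p4,p6,p5], [p3,p2,p1,p5,p4,p6], [p3,p2,p4,p1,p5,p6], [p3,p2,p4,p5,p6,p1],
    [p3,p2,p5,p1,p6,p4], [p3,p2,p5,p4,p1,p6], [p3,p2,p6,p1,p4,p5], [p3,p2,p6,p4,p5,p1]],
   [[p3,p4,p1,p2,p5,p6], [p3,p4,p1,p5,p6,p2], [p3,p4,p2,p1,p6,p5], [p3,p4,p2,p5,p1,p6],
    [p3,p4,p5,p1,p2,p6], [p3,p4,p5,p2,p6,p1], [p3,p4,p6,p1,p5,p2], [p3,p4,p6,p2,p1,p5],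
    [p3,p5,p1,p2,p6,p4], [p3,p5,p1,p4,p2,p6], [p3,p5,p2,p1,p4,p6], [p3,p5,p2,p4,p6,p1]],
   [[p3,p5,p4,p1,p6,p2], [p3,p5,p4,p2,p1,p6], [p3,p5,p6,p1,p2,p4], [p3,p5,p6,p2,p4,p1],
    [p3,p6,p1,p2,p4,p5], [p3,p6,p1,p4,p5,p2], [p3,p6,p2,p1,p5,p4], [p3,p6,p2,p4,p1,p5],
    [p3,p6,p4,p1,p2,p5], [p3,p6,p4,p2,p5,p1], [p3,p6,p5,p1,p4,p2], [p3,p6,p5,p2,p1,p4]],
   [[p4,p1,p2,p3,p6,p5], [p4,p1,p2,p5,p3,p6], [p4,p1,p3,p2,p5,p6], [p4,p1,p3,p5,p6,p2],
    [p4,p1,p5,p2,p6,p3], [p4,p1,p5,p3,p2,p6], [p4,p1,p6,p2,p3,p5], [p4,p1,p6,p3,p5,p2],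
    [p4,p2,p1,p3,p5,p6], [p4,p2,p1,p5,p6,p3], [p4,p2,p3,p1,p6,p5], [p4,p2,p3,p5,p1,p6]],
   [[p4,p2,p5,p1,p3,p6], [p4,p2,p5,p3,p6,p1], [p4,p2,p6,p1,p5,p3], [p4,p2,p6,p3,p1,p5],
    [p4,p3,p1,p2,p6,p5], [p4,p3,p1,p5,p2,p6], [p4,p3,p2,p1,p5,p6], [p4,p3,p2,p5,p6,p1],
    [p4,p3,p5,p1,p6,p2], [p4,p3,p5,p2,p1,p6], [p4,p3,p6,p1,p2,p5], [p4,p3,p6,p2,p5,p1]],
   [[p4,p5,p1,p2,p3,p6], [p4,p5,p1,p3,p6,p2], [p4,p5,p2,p1,p6,p3], [p4,p5,p2,p3,p1,p6],
    [p4,p5,p3,p1,p2,p6], [p4,p5,p3,p2,p6,p1], [p4,p5,p6,p1,p3,p2], [p4,p5,p6,p2,p1,p3],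
    [p4,p6,p1,p2,p5,p3], [p4,p6,p1,p3,p2,p5], [p4,p6,p2,p1,p3,p5], [p4,p6,p2,p3,p5,p1]],
   [[p4,p6,p3,p1,p5,p2], [p4,p6,p3,p2,p1,p5], [p4,p6,p5,p1,p2,p3], [p4,p6,p5,p2,p3,p1],
    [p5,p1,p2,p3,p4,p6], [p5,p1,p2,p4,p6,p3], [p5,p1,p3,p2,p6,p4], [p5,p1,p3,p4,p2,p6],
    [p5,p1,p4,p2,p3,p6], [p5,p1,p4,p3,p6,p2], [p5,p1,p6,p2,p4,p3], [p5,p1,p6,p3,p2,p4]],
   [[p5,p2,p1,p3,p6,p4], [p5,p2,p1,p4,p3,p6], [p5,p2,p3,p1,p4,p6], [p5,p2,p3,p4,p6,p1],
    [p5,p2,p4,p1,p6,p3], [p5,p2,p4,p3,p1,p6], [p5,p2,p6,p1,p3,p4], [p5,p2,p6,p3,p4,p1],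
    [p5,p3,p1,p2,p4,p6], [p5,p3,p1,p4,p6,p2], [p5,p3,p2,p1,p6,p4], [p5,p3,p2,p4,p1,p6]],
   [[p5,p3,p4,p1,p2,p6], [p5,p3,p4,p2,p6,p1], [p5,p3,p6,p1,p4,p2], [p5,p3,p6,p2,p1,p4],
    [p5,p4,p1,p2,p6,p3], [p5,p4,p1,p3,p2,p6], [p5,p4,p2,p1,p3,p6], [p5,p4,p2,p3,p6,p1],
    [p5,p4,p3,p1,p6,p2], [p5,p4,p3,p2,p1,p6], [p5,p4,p6,p1,p2,p3], [p5,p4,p6,p2,p3,p1]],
   [[p5,p6,p1,p2,p3,p4], [p5,p6,p1,p3,p4,p2], [p5,p6,p2,p1,p4,p3], [p5,p6,p2,p3,p1,p4],
    [p5,p6,p3,p1,p2,p4], [p5,p6,p3,p2,p4,p1], [p5,p6,p4,p1,p3,p2], [p5,p6,p4,p2,p1,p3],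
    [p6,p1,p2,p3,p5,p4], [p6,p1,p2,p4,p3,p5], [p6,p1,p3,p2,p4,p5], [p6,p1,p3,p4,p5,p2]],
   [[p6,p1,p4,p2,p5,p3], [p6,p1,p4,p3,p2,p5], [p6,p1,p5,p2,p3,p4], [p6,p1,p5,p3,p4,p2],
    [p6,p2,p1,p3,p4,p5], [p6,p2,p1,p4,p5,p3], [p6,p2,p3,p1,p5,p4], [p6,p2,p3,p4,p1,p5],
    [p6,p2,p4,p1,p3,p5], [p6,p2,p4,p3,p5,p1], [p6,p2,p5,p1,p4,p3], [p6,p2,p5,p3,p1,p4]],
   [[p6,p3,p1,p2,p5,p4], [p6,p3,p1,p4,p2,p5], [p6,p3,p2,p1,p4,p5], [p6,p3,p2,p4,p5,p1],
    [p6,p3,p4,p1,p5,p2], [p6,p3,p4,p2,p1,p5], [p6,p3,p5,p1,p2,p4], [p6,p3,p5,p2,p4,p1],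
    [p6,p4,p1,p2,p3,p5], [p6,p4,p1,p3,p5,p2], [p6,p4,p2,p1,p5,p3], [p6,p4,p2,p3,p1,p5]],
   [[p6,p4,p3,p1,p2,p5], [p6,p4,p3,p2,p5,p1], [p6,p4,p5,p1,p3,p2], [p6,p4,p5,p2,p1,p3],
    [p6,p5,p1,p2,p4,p3], [p6,p5,p1,p3,p2,p4], [p6,p5,p2,p1,p3,p4], [p6,p5,p2,p3,p4,p1],
    [p6,p5,p3,p1,p4,p2], [p6,p5,p3,p2,p1,p4], [p6,p5,p4,p1,p2,p3], [p6,p5,p4,p2,p3,p1]]]"

definition perms_gen15b :: "pos list list list" where
  "perms_gen15b =
  [[[p1,p2,p3,p4,p5,p6], [p1,p2,p3,p5,p6,p4], [p1,p2,p3,p6,p4,p5], [p1,p3,p2,p4,p6,p5],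
    [p2,p1,p3,p4,p6,p5], [p2,p1,p3,p5,p4,p6], [p2,p1,p3,p6,p5,p4], [p2,p3,p1,p4,p5,p6],
    [p3,p1,p2,p4,p5,p6], [p3,p1,p2,p5,p6,p4], [p3,p1,p2,p6,p4,p5], [p3,p2,p1,p4,p6,p5]],
   [[p4,p1,p2,p3,p6,p5], [p4,p1,p2,p5,p3,p6], [p4,p1,p2,p6,p5,p3], [p4,p2,p1,p3,p5,p6],
    [p5,p1,p2,p3,p4,p6], [p5,p1,p2,p4,p6,p3], [p5,p1,p2,p6,p3,p4], [p5,p2,p1,p3,p6,p4],
    [p6,p1,p2,p3,p5,p4], [p6,p1,p2,p4,p3,p5], [p6,p1,p2,p5,p4,p3], [p6,p2,p1,p3,p4,p5]]]"

definition perms_gen51b :: "pos list list list" where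
  "perms_gen51b =
  [[[p1,p2,p3,p4,p5,p6], [p1,p2,p4,p3,p6,p5], [p1,p2,p5,p3,p4,p6], [p1,p2,p6,p3,p5,p4],
    [p2,p1,p3,p4,p6,p5]]]"

definition theta6 :: combination where
  "theta6 = [(gen33, perms_gen33,
  [[-10, 40, -80, 80, -40, 40, 190, 20, -110, -100, 200, 220],
   [-110, -220, -100, -80, 20, 100, 40, 110, -40, -20, 100, 20],
   [130, 80, 80, 100, -50, -40, 20, -80, 20, 100, 40, 110],
   [-40, -20, 100, 20, 150, 30, 240, 270, -240, -270, 150, 30],
   [-90, 60, 240, 180, -60, -90, -90, 120, 30, 30, -30, -30],
   [-120, -60, -120, -60, -90, -90, 120, 30, -240, -120, 60, 90],
   [60]]),
  (gen15a, perms_gen15a,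
  [[88, -52, -148, -2, 46, 8, 356, 346, 560, 28, 106, 374],
   [338, 268, -26, -52, -146, -106, -118, 166, -8, -232, -262, -110],
   [-424, -380, 130, 140, 104, -188, 226, 404, 190, 68, -34, 52],
   [-350, 62, 242, 256, -70, 52, 124, -268, 26, -164, 286, 128],
   [-58, 172, 12, 146, -326, -272, -12, 158, 70, 206, 76, 184],
   [288, -70, -68, -2, -70, -272, -144, 2, 100, 82, 12, -274],
   [376, 350, -170, 100, 54, -28, 16, -26, 108, 138, 192, 48],
   [96, 168, 96, 96, 110, 58, -144, -16, -2, -2, -96, -232],
   [154, 14, -218, -14, -198, -112, 178, 160, -94, 10, 90, 110],
   [-146, -68, 126, -16, 10, -82, 16, -158, -30, 152, 82, -164],
   [-30, 12, 24, -18, -24, -84, 66, 78, -38, 2, 22, 46],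
   [-6, 8, -32, -62, 80, 46, -24, -16, 58, 10, 12, 8],
   [-50, -52, 76, -38, 120, 2, -38, -44, 86, 10, -30, 20],
   [4, 52, 6, -46, 108, 18, -108, -72, -24, 48, 156, 96],
   [170, 58, -24, 104, 118, 58, 24, 8, -26, -46, 22, 46],
   [-18, -112, -122, -20, -94, -50, 90, -10, 34, -128, 126, 104],
   [130, 38, -44, -38, -90, 32, 142, 136, -30, 12, 24, -18],
   [-24, -84, 66, 78, -38, 2, 22, 46, -6, 8, -32, -62],
   [80, 46, -24, -16, 58, 10, 12, 8, -50, -52, 76, -38],
   [120, 2, -38, -44, 86, 10, -30, 20, 4, 52, 6, -46]]),
  (gen15b, perms_gen15b,
  [[216, -72, -72, -288, 216, -72, -72, -288, 36, -12, -12, 12],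
   [36, -12, -12, 12, 36, -12, -12, 12, 36, -12, -12, 12]]),
  (gen51b, perms_gen51b,
  [[240, -60, -60, -60, -300]])]"

definition perms_comm3111 :: "pos list list list" where
  "perms_comm3111 =
  [[[p1,p2,p3,p4,p5,p6], [p1,p2,p3,p5,p6,p4], [p1,p2,p3,p6,p4,p5], [p1,p2,p4,p3,p6,p5],
    [p1,p2,p4,p5,p3,p6], [p1,p2,p4,p6,p5,p3], [p1,p2,p5,p3,p4,p6], [p1,p2,p5,p4,p6,p3],
    [p1,p2,p5,p6,p3,p4], [p1,p2,p6,p3,p5,p4], [p1,p2,p6,p4,p3,p5], [p1,p2,p6,p5,p4,p3]],
   [[p1,p3,p2,p4,p6,p5], [p1,p3,p2,p5,p4,p6], [p1,p3,p2,p6,p5,p4], [p1,p3,p4,p2,p5,p6],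
    [p1,p3,p4,p5,p6,p2], [p1,p3,p4,p6,p2,p5], [p1,p3,p5,p2,p6,p4], [p1,p3,p5,p4,p2,p6],
    [p1,p3,p5,p6,p4,p2], [p1,p3,p6,p2,p4,p5], [p1,p3,p6,p4,p5,p2], [p1,p3,p6,p5,p2,p4]],
   [[p1,p4,p2,p3,p5,p6], [p1,p4,p2,p5,p6,p3], [p1,p4,p2,p6,p3,p5], [p1,p4,p3,p2,p6,p5],
    [p1,p4,p3,p5,p2,p6], [p1,p4,p3,p6,p5,p2], [p1,p4,p5,p2,p3,p6], [p1,p4,p5,p3,p6,p2],
    [p1,p4,p5,p6,p2,p3], [p1,p4,p6,p2,p5,p3], [p1,p4,p6,p3,p2,p5], [p1,p4,p6,p5,p3,p2]],
   [[p1,p5,p2,p3,p6,p4], [p1,p5,p2,p4,p3,p6], [p1,p5,p2,p6,p4,p3], [p1,p5,p3,p2,p4,p6],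
    [p1,p5,p3,p4,p6,p2], [p1,p5,p3,p6,p2,p4], [p1,p5,p4,p2,p6,p3], [p1,p5,p4,p3,p2,p6],
    [p1,p5,p4,p6,p3,p2], [p1,p5,p6,p2,p3,p4], [p1,p5,p6,p3,p4,p2], [p1,p5,p6,p4,p2,p3]],
   [[p1,p6,p2,p3,p4,p5], [p1,p6,p2,p4,p5,p3], [p1,p6,p2,p5,p3,p4], [p1,p6,p3,p2,p5,p4],
    [p1,p6,p3,p4,p2,p5], [p1,p6,p3,p5,p4,p2], [p1,p6,p4,p2,p3,p5], [p1,p6,p4,p3,p5,p2],
    [p1,p6,p4,p5,p2,p3], [p1,p6,p5,p2,p4,p3], [p1,p6,p5,p3,p2,p4], [p1,p6,p5,p4,p3,p2]],
   [[p2,p1,p3,p4,p6,p5], [p2,p1,p3,p5,p4,p6], [p2,p1,p3,p6,p5,p4], [p2,p1,p4,p3,p5,p6],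
    [p2,p1,p4,p5,p6,p3], [p2,p1,p4,p6,p3,p5], [p2,p1,p5,p3,p6,p4], [p2,p1,p5,p4,p3,p6],
    [p2,p1,p5,p6,p4,p3], [p2,p1,p6,p3,p4,p5], [p2,p1,p6,p4,p5,p3], [p2,p1,p6,p5,p3,p4]],
   [[p2,p3,p1,p4,p5,p6], [p2,p3,p1,p5,p6,p4], [p2,p3,p1,p6,p4,p5], [p2,p3,p4,p1,p6,p5],
    [p2,p3,p4,p5,p1,p6], [p2,p3,p4,p6,p5,p1], [p2,p3,p5,p1,p4,p6], [p2,p3,p5,p4,p6,p1],
    [p2,p3,p5,p6,p1,p4], [p2,p3,p6,p1,p5,p4], [p2,p3,p6,p4,p1,p5], [p2,p3,p6,p5,p4,p1]],
   [[p2,p4,p1,p3,p6,p5], [p2,p4,p1,p5,p3,p6], [p2,p4,p1,p6,p5,p3], [p2,p4,p3,p1,p5,p6],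
    [p2,p4,p3,p5,p6,p1], [p2,p4,p3,p6,p1,p5], [p2,p4,p5,p1,p6,p3], [p2,p4,p5,p3,p1,p6],
    [p2,p4,p5,p6,p3,p1], [p2,p4,p6,p1,p3,p5], [p2,p4,p6,p3,p5,p1], [p2,p4,p6,p5,p1,p3]],
   [[p2,p5,p1,p3,p4,p6], [p2,p5,p1,p4,p6,p3], [p2,p5,p1,p6,p3,p4], [p2,p5,p3,p1,p6,p4],
    [p2,p5,p3,p4,p1,p6], [p2,p5,p3,p6,p4,p1], [p2,p5,p4,p1,p3,p6], [p2,p5,p4,p3,p6,p1],
    [p2,p5,p4,p6,p1,p3], [p2,p5,p6,p1,p4,p3], [p2,p5,p6,p3,p1,p4], [p2,p5,p6,p4,p3,p1]],
   [[p2,p6,p1,p3,p5,p4], [p2,p6,p1,p4,p3,p5], [p2,p6,p1,p5,p4,p3], [p2,p6,p3,p1,p4,p5],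
    [p2,p6,p3,p4,p5,p1], [p2,p6,p3,p5,p1,p4], [p2,p6,p4,p1,p5,p3], [p2,p6,p4,p3,p1,p5],
    [p2,p6,p4,p5,p3,p1], [p2,p6,p5,p1,p3,p4], [p2,p6,p5,p3,p4,p1], [p2,p6,p5,p4,p1,p3]],
   [[p3,p1,p4,p2,p6,p5], [p3,p1,p4,p5,p2,p6], [p3,p1,p4,p6,p5,p2], [p3,p1,p5,p2,p4,p6],
    [p3,p1,p5,p4,p6,p2], [p3,p1,p5,p6,p2,p4], [p3,p1,p6,p2,p5,p4], [p3,p1,p6,p4,p2,p5],
    [p3,p1,p6,p5,p4,p2], [p3,p2,p4,p1,p5,p6], [p3,p2,p4,p5,p6,p1], [p3,p2,p4,p6,p1,p5]],
   [[p3,p2,p5,p1,p6,p4], [p3,p2,p5,p4,p1,p6], [p3,p2,p5,p6,p4,p1], [p3,p2,p6,p1,p4,p5],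
    [p3,p2,p6,p4,p5,p1], [p3,p2,p6,p5,p1,p4], [p3,p4,p1,p2,p5,p6], [p3,p4,p1,p5,p6,p2],
    [p3,p4,p1,p6,p2,p5], [p3,p4,p2,p1,p6,p5], [p3,p4,p2,p5,p1,p6], [p3,p4,p2,p6,p5,p1]],
   [[p3,p4,p5,p1,p2,p6], [p3,p4,p5,p2,p6,p1], [p3,p4,p5,p6,p1,p2], [p3,p4,p6,p1,p5,p2],
    [p3,p4,p6,p2,p1,p5], [p3,p4,p6,p5,p2,p1], [p3,p5,p1,p2,p6,p4], [p3,p5,p1,p4,p2,p6],
    [p3,p5,p1,p6,p4,p2], [p3,p5,p2,p1,p4,p6], [p3,p5,p2,p4,p6,p1], [p3,p5,p2,p6,p1,p4]],
   [[p3,p5,p4,p1,p6,p2], [p3,p5,p4,p2,p1,p6], [p3,p5,p4,p6,p2,p1], [p3,p5,p6,p1,p2,p4],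
    [p3,p5,p6,p2,p4,p1], [p3,p5,p6,p4,p1,p2], [p3,p6,p1,p2,p4,p5], [p3,p6,p1,p4,p5,p2],
    [p3,p6,p1,p5,p2,p4], [p3,p6,p2,p1,p5,p4], [p3,p6,p2,p4,p1,p5], [p3,p6,p2,p5,p4,p1]],
   [[p3,p6,p4,p1,p2,p5], [p3,p6,p4,p2,p5,p1], [p3,p6,p4,p5,p1,p2], [p3,p6,p5,p1,p4,p2],
    [p3,p6,p5,p2,p1,p4], [p3,p6,p5,p4,p2,p1], [p4,p1,p5,p2,p6,p3], [p4,p1,p5,p3,p2,p6],
    [p4,p1,p5,p6,p3,p2], [p4,p1,p6,p2,p3,p5], [p4,p1,p6,p3,p5,p2], [p4,p1,p6,p5,p2,p3]],
   [[p4,p2,p5,p1,p3,p6], [p4,p2,p5,p3,p6,p1], [p4,p2,p5,p6,p1,p3], [p4,p2,p6,p1,p5,p3],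
    [p4,p2,p6,p3,p1,p5], [p4,p2,p6,p5,p3,p1], [p4,p3,p5,p1,p6,p2], [p4,p3,p5,p2,p1,p6],
    [p4,p3,p5,p6,p2,p1], [p4,p3,p6,p1,p2,p5], [p4,p3,p6,p2,p5,p1], [p4,p3,p6,p5,p1,p2]],
   [[p4,p5,p1,p2,p3,p6], [p4,p5,p1,p3,p6,p2], [p4,p5,p1,p6,p2,p3], [p4,p5,p2,p1,p6,p3],
    [p4,p5,p2,p3,p1,p6], [p4,p5,p2,p6,p3,p1], [p4,p5,p3,p1,p2,p6], [p4,p5,p3,p2,p6,p1],
    [p4,p5,p3,p6,p1,p2], [p4,p5,p6,p1,p3,p2], [p4,p5,p6,p2,p1,p3], [p4,p5,p6,p3,p2,p1]],
   [[p4,p6,p1,p2,p5,p3], [p4,p6,p1,p3,p2,p5], [p4,p6,p1,p5,p3,p2], [p4,p6,p2,p1,p3,p5],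
    [p4,p6,p2,p3,p5,p1], [p4,p6,p2,p5,p1,p3], [p4,p6,p3,p1,p5,p2], [p4,p6,p3,p2,p1,p5],
    [p4,p6,p3,p5,p2,p1], [p4,p6,p5,p1,p2,p3], [p4,p6,p5,p2,p3,p1], [p4,p6,p5,p3,p1,p2]],
   [[p5,p1,p6,p2,p4,p3], [p5,p1,p6,p3,p2,p4], [p5,p1,p6,p4,p3,p2], [p5,p2,p6,p1,p3,p4],
    [p5,p2,p6,p3,p4,p1], [p5,p2,p6,p4,p1,p3], [p5,p3,p6,p1,p4,p2], [p5,p3,p6,p2,p1,p4],
    [p5,p3,p6,p4,p2,p1], [p5,p4,p6,p1,p2,p3], [p5,p4,p6,p2,p3,p1], [p5,p4,p6,p3,p1,p2]],
   [[p5,p6,p1,p2,p3,p4], [p5,p6,p1,p3,p4,p2], [p5,p6,p1,p4,p2,p3], [p5,p6,p2,p1,p4,p3],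
    [p5,p6,p2,p3,p1,p4], [p5,p6,p2,p4,p3,p1], [p5,p6,p3,p1,p2,p4], [p5,p6,p3,p2,p4,p1],
    [p5,p6,p3,p4,p1,p2], [p5,p6,p4,p1,p3,p2], [p5,p6,p4,p2,p1,p3], [p5,p6,p4,p3,p2,p1]]]"

definition perms_comm1311 :: "pos list list list" where
  "perms_comm1311 =
  [[[p1,p2,p3,p4,p5,p6], [p1,p2,p3,p5,p6,p4], [p1,p2,p4,p3,p6,p5], [p1,p2,p4,p5,p3,p6],
    [p1,p2,p5,p3,p4,p6], [p1,p2,p5,p4,p6,p3], [p1,p2,p6,p3,p5,p4], [p1,p2,p6,p4,p3,p5],
    [p1,p3,p2,p4,p6,p5], [p1,p3,p2,p5,p4,p6], [p1,p3,p4,p2,p5,p6], [p1,p3,p4,p5,p6,p2]],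
   [[p1,p3,p5,p2,p6,p4], [p1,p3,p5,p4,p2,p6], [p1,p3,p6,p2,p4,p5], [p1,p3,p6,p4,p5,p2],
    [p1,p4,p2,p3,p5,p6], [p1,p4,p2,p5,p6,p3], [p1,p4,p3,p2,p6,p5], [p1,p4,p3,p5,p2,p6],
    [p1,p4,p5,p2,p3,p6], [p1,p4,p5,p3,p6,p2], [p1,p4,p6,p2,p5,p3], [p1,p4,p6,p3,p2,p5]],
   [[p1,p5,p2,p3,p6,p4], [p1,p5,p2,p4,p3,p6], [p1,p5,p3,p2,p4,p6], [p1,p5,p3,p4,p6,p2],
    [p1,p5,p4,p2,p6,p3], [p1,p5,p4,p3,p2,p6], [p1,p5,p6,p2,p3,p4], [p1,p5,p6,p3,p4,p2],
    [p1,p6,p2,p3,p4,p5], [p1,p6,p2,p4,p5,p3], [p1,p6,p3,p2,p5,p4], [p1,p6,p3,p4,p2,p5]],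
   [[p1,p6,p4,p2,p3,p5], [p1,p6,p4,p3,p5,p2], [p1,p6,p5,p2,p4,p3], [p1,p6,p5,p3,p2,p4],
    [p2,p1,p3,p4,p6,p5], [p2,p1,p3,p5,p4,p6], [p2,p1,p4,p3,p5,p6], [p2,p1,p4,p5,p6,p3],
    [p2,p1,p5,p3,p6,p4], [p2,p3,p1,p4,p5,p6], [p2,p3,p1,p5,p6,p4], [p2,p3,p4,p1,p6,p5]],
   [[p2,p3,p4,p5,p1,p6], [p2,p3,p5,p1,p4,p6], [p2,p3,p5,p4,p6,p1], [p2,p3,p6,p1,p5,p4],
    [p2,p3,p6,p4,p1,p5], [p2,p4,p1,p3,p6,p5], [p2,p4,p3,p1,p5,p6], [p2,p4,p3,p5,p6,p1],
    [p2,p4,p5,p1,p6,p3], [p3,p1,p4,p2,p6,p5], [p3,p1,p4,p5,p2,p6], [p3,p1,p5,p2,p4,p6]],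
   [[p3,p2,p4,p1,p5,p6], [p3,p2,p4,p5,p6,p1], [p3,p2,p5,p1,p6,p4], [p3,p4,p1,p2,p5,p6],
    [p3,p4,p2,p1,p6,p5], [p3,p4,p5,p1,p2,p6], [p4,p1,p5,p2,p6,p3], [p4,p2,p5,p1,p3,p6],
    [p4,p3,p5,p1,p6,p2]]]"

definition perms_rel45 :: "pos list list list" where
  "perms_rel45 =
  [[[p1,p2,p3,p4,p5,p6], [p1,p2,p3,p5,p6,p4], [p1,p2,p3,p6,p4,p5], [p1,p2,p4,p3,p6,p5],
    [p1,p2,p4,p5,p3,p6], [p1,p2,p4,p6,p5,p3], [p1,p2,p5,p3,p4,p6], [p1,p2,p5,p4,p6,p3],
    [p1,p3,p2,p4,p6,p5], [p1,p3,p2,p5,p4,p6], [p1,p3,p2,p6,p5,p4], [p1,p3,p4,p2,p5,p6]],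
   [[p1,p3,p4,p5,p6,p2], [p1,p3,p4,p6,p2,p5], [p1,p3,p5,p2,p6,p4], [p1,p3,p5,p4,p2,p6],
    [p1,p4,p2,p3,p5,p6], [p1,p4,p2,p6,p3,p5], [p1,p4,p5,p2,p3,p6], [p1,p4,p5,p3,p6,p2],
    [p2,p1,p3,p4,p6,p5], [p2,p1,p3,p5,p4,p6], [p2,p1,p3,p6,p5,p4], [p2,p1,p4,p3,p5,p6]],
   [[p2,p1,p4,p6,p3,p5], [p2,p1,p5,p4,p3,p6], [p2,p3,p1,p4,p5,p6], [p2,p3,p1,p5,p6,p4],
    [p2,p3,p1,p6,p4,p5], [p2,p3,p4,p1,p6,p5], [p2,p3,p4,p5,p1,p6], [p2,p3,p4,p6,p5,p1],
    [p2,p3,p5,p1,p4,p6], [p2,p3,p5,p4,p6,p1], [p2,p4,p1,p3,p6,p5]]]"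

text \<open>Writes 360 times the generator minus \<open>theta6\<close> of its words as a combination
  of permuted relations; likewise for the other generators of degree 6.\<close>

definition cert_gen33 :: combination where
  "cert_gen33 = [(comm3111, perms_comm3111,
  [[610, 685, 325, 730, 940, 1255, 2545, 2530, 2275, -770, -740, -1280],
   [890, 305, 1010, 1150, 1030, 1015, -380, -275, -200, -2465, -1145, -1055],
   [275, -325, -190, -2440, -2020, -2125, 55, 130, 85, -620, -995, -800],
   [-2245, -1900, -2170, 2765, 2105, 2855, -1045, -955, -1750, -1070, -170, -20],
   [-745, 590, 185, -820, -670, -475, 1190, 950, 1550, 2870, 2885, 2780],
   [790, 475, 805, 1960, 1285, 1120, -1160, -1010, -1010, -2000, -1475, -1310],
   [485, 5, -400, 100, 2395, 1990, 4075, 895, 1405, -1415, -815, -590],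
   [-145, 230, 455, -640, 1085, 890, -2765, -380, -320, -1415, -680, -455],
   [1190, 1445, 1190, 1580, 1910, 1565, 2975, 710, 980, 2755, -755, -890],
   [-1960, -2335, -2815, 785, -1735, -1885, -2410, -925, -955, -2380, -655, -1420],
   [-1025, -605, -695, 3040, 2395, 2275, -1550, -1205, -1235, 2020, -245, -515],
   [1750, 1690, 1030, -2330, -710, -1100, -295, -655, -865, -460, 1220, 1370],
   [2740, 1750, 1750, 4015, -290, -770, 365, 920, 815, -400, 785, 1010],
   [-2050, 965, 1025, -2240, 235, 1255, -145, -235, -130, 935, -2155, -2080],
   [-2035, 800, 680, 1340, 800, 245, -620, -725, -1310, -80, 2110, 2425],
   [160, -1625, -1340, -1685, -785, -800, 70, 1750, 1750, -545, 1495, 1495],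
   [-1600, 125, 725, -2080, -2800, -2950, 530, 305, 305, 1945, 1060, 3250],
   [2120, 1475, 1355, 560, -700, -430, 2465, 1400, 1400, -205, 965, 695],
   [1900, 535, 1540, -1640, -200, -215, 2320, -710, -785, 2455, 3370, 1675],
   [875, 860, 575, 1310, 350, 1025, -1435, 755, 755, 1775, 2135, 1640]]),
  (comm1311, perms_comm1311,
  [[900, -780, 3525, 2190, 2685, 2040, -990, -225, 1305, -135, 1170, 1665],
   [1050, -795, -2100, -1545, -885, -3105, -3810, -660, -2490, 1455, -3300, 1275],
   [-4785, -1065, 1260, 705, 405, -3165, 1440, -3105, 2865, 1680, 2625, -675],
   [240, 285, 2430, 1890, 2190, -495, -495, -75, -480, -270, -1695, 600],
   [-840, -165, 1860, 360, 2220, 900, -210, -285, 1380, -75, 540, -15],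
   [-330, 540, -255, -540, 390, 810, -690, -660, 30]]),
  (rel45, perms_rel45,
  [[645, -705, 165, -135, 285, -600, 330, 435, -225, 825, 0, 600],
   [330, 255, 60, 405, 360, 180, 0, -90, 45, -240, 195, -285],
   [-15, -270, -465, -165, -615, -180, -375, -405, -195, -840, 0]])]"

definition cert_gen15a :: combination where
  "cert_gen15a = [(comm3111, perms_comm3111,
  [[-320, 295, -95, -800, -590, -605, -95, -20, -605, -920, -1550, -1190],
   [-850, -1315, -370, -470, -200, -185, -50, 235, 130, 715, 355, 235],
   [875, 755, 950, 110, 170, 95, 1495, 910, 1075, -560, -1295, -770],
   [305, 50, 230, -1735, -2155, -1585, -655, -655, -850, 70, 940, -260],
   [1685, 2330, 2315, 680, 740, 1115, -1630, -1360, -1180, 1940, 875, 1490],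
   [-20, -185, 85, 250, -305, -230, -80, -20, 100, 400, 775, 820],
   [-505, -505, -670, -440, -665, -680, 1945, 415, 745, 925, -155, -1010],
   [-355, 20, -205, -2890, -1585, -1810, 115, 130, 400, -2495, -620, -605],
   [1880, 2015, 1550, 1400, -670, -655, 485, 1160, 1400, 1165, 1375, -140],
   [710, 665, 425, -295, 5, 245, -400, -1075, -1525, 530, -175, 710],
   [-1025, -1145, -1115, -980, -1115, -875, 100, 115, 325, -650, -185, -125],
   [1330, -200, -140, 250, 1390, 1390, 95, 5, 215, 650, 350, 470],
   [1690, 160, 340, -815, -80, -1100, -1915, -1630, -1735, -130, -25, -160],
   [-1600, -295, -565, 850, 355, -185, 755, 665, 350, 545, 875, 620],
   [95, -160, -310, -1750, 590, -55, 190, -185, -290, -1790, -80, 85],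
   [1870, 1195, 1540, 265, -1025, -1400, -2090, 1690, 1690, -785, -695, -695],
   [320, 755, 1235, 290, 920, 860, 1490, 365, 365, -65, -680, 1060],
   [-1510, -1915, -1765, -10, -700, -400, -865, -850, -850, -1585, -1075, -1285],
   [1600, 745, 160, 1990, -260, -305, 160, 1360, 295, -725, -260, -485],
   [125, 800, 485, -2260, 530, -625, 1625, 1775, 1775, 1265, -805, -340]]),
  (comm1311, perms_comm1311,
  [[390, 150, -735, 150, -465, 90, -1590, -1125, 1185, -1665, 450, -1995],
   [2130, -315, 480, -555, 1845, 135, -1260, 1500, 570, 1275, -1620, 135],
   [-285, 15, -930, -1515, -2115, -165, 960, 15, 885, 3780, 195, 855],
   [-1980, -1155, 30, 30, 1740, 465, -615, -1065, -1320, -210, -225, -540],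
   [240, 75, 1560, -150, 720, -510, -600, -1665, 90, -1335, -840, 15],
   [240, -840, 555, 840, -1020, 450, -1200, -270, 930]]),
  (rel45, perms_rel45,
  [[405, -255, 285, 45, 315, -120, 270, 345, -75, 435, 390, 360],
   [540, 735, 420, 45, 210, 210, 0, 0, 225, -450, 225, -345],
   [-45, -300, -375, 315, 255, 150, -135, 255, -285, -60, 0]])]"

definition cert_gen15b :: combination where
  "cert_gen15b = [(comm3111, perms_comm3111,
  [[1035, 1635, 1590, -210, 210, -495, -780, -30, -630, -150, -1515, -465],
   [-390, -1245, -975, -1935, -2145, -1800, -1065, -1185, -915, 1170, 855, 840],
   [135, 330, 0, -750, -1020, -360, 2280, 960, 1290, 915, 1905, 930],
   [5490, 4680, 4545, -2370, -2565, -1920, -3690, -3615, -3630, -2235, 390, -1035],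
   [-3120, -3105, -2850, 5565, 5790, 5370, -3075, -1575, -960, -990, 90, -1485],
   [1440, 1050, 1125, -480, -510, -570, 3795, 3225, 3240, -1950, -1395, -1440],
   [675, 1260, 825, -2595, -1875, -1575, 2790, 3180, 3885, 4425, -540, -510],
   [-2460, -2580, -3015, 915, -2055, -2370, -2385, 1455, 1815, -2715, -2400, -2505],
   [1035, 2190, 1320, -555, 1845, 2415, -2070, 645, 990, -3105, 255, -1500],
   [-45, 150, 135, -315, 705, 840, 1305, -2820, -3210, 3510, -225, 120],
   [-2250, -1905, -2025, -2250, -2115, -1725, 4245, 4125, 3585, -4755, -3405, -3645],
   [3600, -435, -135, 480, 1725, 1815, -735, -1125, -870, 120, -3525, -3360],
   [-1665, -2010, -1950, -2340, 1635, 825, -105, -420, -435, -375, 495, 300],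
   [2430, -3990, -4080, 3285, 2385, 1545, 2715, 2625, 2745, -375, 1635, 1545],
   [-960, 585, 465, -435, 2295, 2430, -2790, -2520, -2415, -2925, -2025, -1575],
   [-285, 360, 405, -3390, -1245, -1755, -2670, -1125, -1035, 2010, 60, 30],
   [-390, -2445, -2310, -465, 2100, 2235, 1755, -1485, -1545, 465, -2205, 165],
   [-2295, -1950, -2505, 2670, -1350, -915, -2040, 1770, 1890, -3630, -3105, -2400],
   [-1665, 1395, -630, 765, -2295, -1965, 1905, 2430, 3735, -3435, -2760, -180],
   [-1590, 345, 600, -2355, -2580, -5070, -750, 2400, 2400, 2700, -810, 2730]]),
  (comm1311, perms_comm1311,
  [[1290, 3255, -1650, 3060, 1455, -2070, -495, -3090, -300, 30, -3315, -2355],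
   [450, -3690, 2460, 300, 2925, 1770, 1650, -2535, 1455, 1935, 900, 1050],
   [3225, 3870, -4230, 2100, -5115, 1410, -3045, 945, -6600, 1725, 4065, 3285],
   [2790, -3900, 1170, -3300, 2550, 3540, 255, 1305, -990, 585, 2580, 930],
   [1635, 1740, 1695, -930, -1650, -870, 0, 1440, 105, -1665, -2085, 270],
   [-1545, -2085, -825, 210, -1290, 225, 45, -135, 1485]]),
  (rel45, perms_rel45,
  [[15, 420, -345, -210, -255, -450, 75, 180, -645, 300, 990, 45],
   [-75, -390, 75, 180, 0, 270, -330, 330, 720, -225, 45, -135],
   [330, -435, -330, 285, 810, 465, 180, 690, -285, 105, 300]])]"

definition cert_gen51a :: combination where
  "cert_gen51a = [(comm3111, perms_comm3111,
  [[1005, 480, 1020, 3180, 3810, 4125, 3555, 3090, 3225, -1680, -2775, -2130],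
   [-2160, -1185, -780, 390, 570, -285, -975, -660, -1275, -1920, -2055, -1995],
   [1215, -795, 240, -2250, -1950, -2775, -1050, 1095, 780, -465, 15, -105],
   [-2445, -2190, -1620, 1515, 1035, 1275, -390, -690, -1335, -45, 270, 900],
   [210, 510, -45, -825, -180, -330, 1125, 795, 945, 3405, 1740, 2205],
   [-495, 90, 30, 1560, 525, 1110, -555, -555, -45, -1440, -1365, -1590],
   [-375, -1785, -600, -345, 735, -60, 2085, 750, 450, -975, -45, -105],
   [1590, 2445, 3120, -1830, 510, -165, -660, 525, 225, 45, -615, -30],
   [3225, 2250, 2775, 2085, 1410, 585, 5535, 1530, 1140, 3360, 345, -135],
   [-3795, -4980, -4470, -2160, -1620, -1860, -2910, -1560, -675, -3300, -1695, -2520],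
   [-420, -720, -930, 2190, 795, 1485, -1905, -660, -450, 750, -1200, -1200],
   [1410, 1320, 1020, -2640, -465, -915, -1140, -1590, -1500, -1845, 270, -30],
   [1440, 315, 405, 2715, -1875, -810, 540, 855, 390, -825, 45, 300],
   [-2655, 975, 1065, -2325, 510, 1890, 1815, 1215, 570, 2370, -840, -315],
   [-1560, 360, 360, 2265, 1335, -90, 585, -420, -675, -135, 2010, 1455],
   [2730, -1560, -1305, -645, -495, -120, -720, 2115, 2025, -1410, 2565, 2565],
   [-3780, -105, 495, -3000, -2250, -2250, -180, 1050, 960, 2475, -120, 1845],
   [1530, 1095, 1515, 1950, -480, -750, 2850, 105, 195, -600, 2775, 1320],
   [2265, 870, 1410, -1650, 45, -750, 3555, -1245, -1560, 495, 3000, 2295],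
   [2340, 1050, 495, 1185, 240, 750, -1665, 2040, 2100, 2730, 2070, -90]]),
  (comm1311, perms_comm1311,
  [[1890, 1800, 4215, 3765, 1950, 3975, -1035, 1140, -630, -2820, 810, 690],
   [-375, -2235, -3990, -3240, -2385, -5115, -4080, -1050, 270, 750, -1575, 630],
   [-3525, -2625, 1200, -285, 1170, -2265, 2325, -1620, 3540, 2925, 525, 15],
   [-675, 795, 1005, 2115, 1965, -2160, -1335, -315, 1065, -1395, -705, 285],
   [-1905, -915, 1095, 1620, 3000, 1380, -1740, -1590, 405, -930, -315, -150],
   [-780, -315, -660, -480, 150, 345, -195, -675, 615]]),
  (rel45, perms_rel45,
  [[690, -990, 465, 165, 555, -120, 345, 510, 495, 615, 375, 915],
   [1425, 1455, 645, -150, 165, -390, -255, -465, -855, 210, 435, 135],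
   [-795, 210, -255, -615, -1305, -810, -615, -1425, 195, -300, -510]])]"

definition cert_gen51b :: combination where
  "cert_gen51b = [(comm3111, perms_comm3111,
  [[40, 15, -165, -150, -210, -335, 65, 410, -15, -320, -350, -750],
   [290, 155, 550, 210, 100, 235, -580, -355, -20, 375, 95, 265],
   [-345, -785, -560, 130, 110, 255, 45, -20, -5, -320, -155, -60],
   [-85, 130, 170, 785, 645, 715, 685, 425, 210, 0, 40, -620],
   [-485, 110, 145, 410, 180, 335, 250, -370, -330, 40, -15, 390],
   [620, 695, 675, 110, -345, -250, -110, 90, 150, -70, 65, 50],
   [385, -115, 170, -630, -365, -740, -735, -725, -765, 355, 595, 220],
   [335, 390, 315, -440, 125, -210, -335, -80, -290, -275, -490, -495],
   [360, 515, 210, 760, -150, -425, -295, -190, 0, 35, -25, -580],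
   [-70, 35, -385, 265, -125, 215, -890, 5, 355, 110, -445, -10],
   [25, -245, 275, 170, -45, -85, -30, -35, -155, 10, 55, -245],
   [-110, -380, -230, 370, 500, 420, 135, 85, -35, -200, 270, 130],
   [820, 440, 270, 145, -50, -100, -785, -700, -325, -810, -675, -580],
   [-540, -455, -225, -390, -195, -105, 775, 495, 490, 405, 875, 740],
   [595, 610, 620, 740, 570, 395, 510, 25, 60, 130, 80, -185],
   [90, -375, -100, -205, 225, 30, -150, -110, 130, -405, 55, 55],
   [170, 55, 345, -360, 520, 210, 300, -25, -25, -35, -240, 720],
   [-220, -375, -45, -300, -520, -380, 165, -360, -300, -295, -285, -645],
   [-140, 335, 20, 520, 60, -225, 570, 390, 235, -305, 70, -335],
   [135, -530, -515, -440, -280, -85, -15, 295, 295, -195, -905, -490]]),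
  (comm1311, perms_comm1311,
  [[-230, -30, 385, 310, 65, 460, -390, -265, 755, -295, 110, -395],
   [30, 125, 50, -475, -415, -335, -460, 310, -270, -25, -50, 45],
   [-225, -525, 1320, 225, -265, 295, 330, -455, 5, 10, 35, 835],
   [-770, 355, 60, 210, 960, 415, -105, -155, -220, -210, -405, -960],
   [-750, -635, -560, 210, 380, 170, -100, -65, 30, -215, 500, 555],
   [100, -640, -65, 590, -320, 620, -500, -90, -50]]),
  (rel45, perms_rel45,
  [[50, -650, -55, 275, -15, -210, 55, -70, -125, 85, -345, 135],
   [165, -45, -385, 30, -205, 10, 105, -105, -135, -350, 205, -125],
   [-285, -140, -375, -95, -195, -10, -45, -55, -225, -260, -140]])]"

section \<open>Verification of the certificates by rewriting\<close>

lemmas form_eval =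
  gen13_def gen31_def gen33_def gen15a_def gen15b_def gen51a_def gen51b_def
  comm1111_def comm3111_def comm1311_def commutator_terms_def
  rel45_def identity_45_terms_def Let_def normalize_def
  pair_form.simps expand.simps tensor_def split_pos_simps pos_of_simps letter_simps
  list.map concat.simps append.simps prod.case list.sel trie_words.simps if_True if_False rel_simps

lemmas trie_eval =
  add_trie.simps single_trie.simps zero_trie.simps form_trie.simps row_trie.simps
  comb_trie.simps data_trie.simps subst_trie.simps letter_simps list.map append.simps
  simp_thms arith_simps arith_special Num.inc.simps mult_1_left mult_1_right mult_minus_left mult_minus_right
  minus_minus add_0_left add_0_right mult_zero_right mult_zero_left minus_zero

lemmas perms_defs = perms_gen13_def perms_gen31_def perms_comm1111_def
  perms_gen33_def perms_gen15a_def perms_gen15b_def perms_gen51b_def perms_comm3111_def perms_comm1311_def perms_rel45_def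

text \<open>An identity with integer coefficients between formal sums. It involves no algebra and no
  field, so one evaluation serves them all.\<close>

definition certifies ::
    "int \<Rightarrow> combination \<Rightarrow> form \<Rightarrow>
      combination \<Rightarrow> bool" where
  "certifies d l b rel \<longleftrightarrow>
     zero_trie (add_trie (subst_trie l b)
      (add_trie (form_trie [p1, p2, p3, p4, p5, p6] (- d) b)
        (data_trie [p1, p2, p3, p4, p5, p6] 1 rel)))"

lemma certifies_gen13: "certifies 12 theta4 gen13 cert_gen13"
  by (simp only: certifies_def theta4_def cert_gen13_def perms_defs form_eval trie_eval)

lemma certifies_gen31: "certifies 12 theta4 gen31 cert_gen31"
  by (simp only: certifies_def theta4_def cert_gen31_def perms_defs form_eval trie_eval)

lemma certifies_gen33: "certifies 360 theta6 gen33 cert_gen33"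
  by (simp only: certifies_def theta6_def cert_gen33_def perms_defs form_eval trie_eval)

lemma certifies_gen15a: "certifies 360 theta6 gen15a cert_gen15a"
  by (simp only: certifies_def theta6_def cert_gen15a_def perms_defs form_eval trie_eval)

lemma certifies_gen15b: "certifies 360 theta6 gen15b cert_gen15b"
  by (simp only: certifies_def theta6_def cert_gen15b_def perms_defs form_eval trie_eval)

lemma certifies_gen51a: "certifies 360 theta6 gen51a cert_gen51a"
  by (simp only: certifies_def theta6_def cert_gen51a_def perms_defs form_eval trie_eval)

lemma certifies_gen51b: "certifies 360 theta6 gen51b cert_gen51b"
  by (simp only: certifies_def theta6_def cert_gen51b_def perms_defs form_eval trie_eval)

lemma positions_below_6: "positions_below 6 u"
  unfolding positions_below_def
proof
  fix p show "pos_index p < 6" by (cases p) simp_all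
qed

lemma data_below_theta4: "data_below 4 theta4" "data_below 4 cert_gen13" "data_below 4 cert_gen31"
  by (simp_all add: data_below_def theta4_def cert_gen13_def cert_gen31_def perms_defs form_eval
      form_below_def permutations_below_def positions_below_def pos_of_def)

lemma permutations_below_6:
  "permutations_below 6 perms_gen33" "permutations_below 6 perms_gen15a"
  "permutations_below 6 perms_gen15b" "permutations_below 6 perms_gen51b"
  "permutations_below 6 perms_comm3111" "permutations_below 6 perms_comm1311"
  "permutations_below 6 perms_rel45"
  unfolding permutations_below_def perms_defs
  by (simp_all add: positions_below_6)

lemma data_below_theta6: "data_below 6 theta6"
  "data_below 6 cert_gen33" "data_below 6 cert_gen15a" "data_below 6 cert_gen15b"
  "data_below 6 cert_gen51a" "data_below 6 cert_gen51b"
  by (simp_all add: data_below_def permutations_below_6 form_below_def positions_below_6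
      theta6_def cert_gen33_def cert_gen15a_def cert_gen15b_def cert_gen51a_def cert_gen51b_def)

lemma gen_lengths:
  "\<forall>(c, t, u) \<in> set gen13. 4 \<le> length u" "\<forall>(c, t, u) \<in> set gen31. 4 \<le> length u"
  "\<forall>(c, t, u) \<in> set gen33. 6 \<le> length u" "\<forall>(c, t, u) \<in> set gen15a. 6 \<le> length u"
  "\<forall>(c, t, u) \<in> set gen15b. 6 \<le> length u" "\<forall>(c, t, u) \<in> set gen51a. 6 \<le> length u"
  "\<forall>(c, t, u) \<in> set gen51b. 6 \<le> length u"
  by (simp_all add: form_eval)

lemma cert_forms:
  "fst ` set cert_gen13 \<subseteq> {comm1111}" "fst ` set cert_gen31 \<subseteq> {comm1111}"
  "fst ` set cert_gen33 \<subseteq> {comm3111, comm1311, rel45}"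
  "fst ` set cert_gen15a \<subseteq> {comm3111, comm1311, rel45}"
  "fst ` set cert_gen15b \<subseteq> {comm3111, comm1311, rel45}"
  "fst ` set cert_gen51a \<subseteq> {comm3111, comm1311, rel45}"
  "fst ` set cert_gen51b \<subseteq> {comm3111, comm1311, rel45}"
  by (simp_all add: cert_gen13_def cert_gen31_def cert_gen33_def cert_gen15a_def cert_gen15b_def
      cert_gen51a_def cert_gen51b_def)

section \<open>Extension of the factorization to degrees 5 and 7\<close>

context jacobi_derivation_algebra
begin

text \<open>The normalized theta of the certificates, expressed through the \<open>\<psi>\<close> of
  lower degree.\<close>

definition weighted_sum :: "(nat \<Rightarrow> 'b) \<Rightarrow> (nat list \<Rightarrow> 'b) \<Rightarrow>
    combination \<Rightarrow> int \<Rightarrow> nat \<Rightarrow> nat list \<Rightarrow> 'b" where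
  "weighted_sum v \<psi> l d i w = scale (inverse (of_int d))
     (data_sum (\<lambda>t. split_value v \<psi> i (Suc (pos_index t))) w l)"

lemma weighted_sum_correct:
  assumes cert: "certifies d l (pair_form [(1, y, z)]) rel"
    and forms: "fst ` set rel \<subseteq> B"
    and null: "\<And>b w. b \<in> B \<Longrightarrow> distinct w \<Longrightarrow> length w = n \<Longrightarrow>
      form_sum (\<lambda>t u. split_value v \<psi> i (Suc (pos_index t)) (map (letter w) u)) b = 0"
    and l: "data_below n l" and b: "\<forall>(c, t, u) \<in> set (pair_form [(1, y, z)]). n \<le> length u"
    and rel: "data_below n rel" and yz: "term_in_range n y z"
    and w: "distinct (i # w)" "length w = n" and d: "of_int d \<noteq> (0 :: 'a)"
    and ren: "rename ((!) w) y = y'" "rename ((!) w) z = z'"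
  shows "W y' (\<lambda>p. W z' (\<lambda>r.
    weighted_sum v \<psi> l d i (p @ r) - split_value v \<psi> i (length p) (p @ r))) = 0"
proof -
  let ?g = "\<lambda>k u. weighted_sum v \<psi> l d i u - split_value v \<psi> i k u"
  have "n \<le> 6" using yz by (simp add: term_in_range_def)
  have "form_sum (\<lambda>t u. ?g (Suc (pos_index t)) (map (letter w) u)) (pair_form [(1, y, z)]) = 0"
    unfolding weighted_sum_def
    by (rule certificate[where rel = rel and n = n and i = i])
      (use cert[unfolded certifies_def] forms null l b rel w d \<open>n \<le> 6\<close> in force)+
  moreover have "form_sum (\<lambda>t u. ?g (Suc (pos_index t)) (map (letter w) u)) (pair_form [(1, y, z)]) =
      W y (\<lambda>p. W z (\<lambda>r. ?g (Suc (pos_index (pos_of (length p - 1)))) (map (letter w) (map pos_of (p @ r)))))"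
    unfolding form_sum_pair_form by simp
  moreover have "term_in_range (length w) y z" using yz w by simp
  ultimately show ?thesis by (simp only: W_pos[of w y z ?g] ren)
qed

lemma factors_5:
  assumes "of_int 12 \<noteq> (0 :: 'a)"
  shows "\<exists>\<psi>. factors v 5 \<psi>"
proof -
  obtain \<psi> where \<psi>: "factors v 3 \<psi>" using factors_3 by blast
  have "\<exists>\<psi>'. factors v (3 + 2) \<psi>'"
  proof (rule factors_extend[OF \<psi>, where \<theta> = "weighted_sum v \<psi> theta4 12"])
    fix i y z
    assume dist: "distinct (vars \<langle>(Var i) y z\<rangle>)" and len: "length (vars y @ vars z) = Suc 3"
    have null: "form_sum (\<lambda>t u. split_value v \<psi> i (Suc (pos_index t)) (map (letter w) u)) b = 0"
      if "b \<in> {comm1111}" "distinct w" "length w = 4" for b w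
      using that form_sum_commutator_terms[OF \<psi> that(2), of "Var 0" "Var 1" "Var 2" "Var 3"]
      by (simp add: comm1111_def commutator_terms_def term_in_range_def)
    have gen13: "W (Var a) (\<lambda>p. W \<langle>(Var b) (Var c) (Var d)\<rangle> (\<lambda>r.
        weighted_sum v \<psi> theta4 12 i (p @ r) - split_value v \<psi> i (length p) (p @ r))) = 0"
      if "distinct [i, a, b, c, d]" for a b c d
      by (rule weighted_sum_correct[OF certifies_gen13[unfolded gen13_def] cert_forms(1) null data_below_theta4(1)
          gen_lengths(1)[unfolded gen13_def] data_below_theta4(2), where w = "[a, b, c, d]"])
        (use that assms in \<open>simp_all add: term_in_range_def\<close>)
    have gen31: "W \<langle>(Var a) (Var b) (Var c)\<rangle> (\<lambda>p. W (Var d) (\<lambda>r.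
        weighted_sum v \<psi> theta4 12 i (p @ r) - split_value v \<psi> i (length p) (p @ r))) = 0"
      if "distinct [i, a, b, c, d]" for a b c d
      by (rule weighted_sum_correct[OF certifies_gen31[unfolded gen31_def] cert_forms(2) null data_below_theta4(1)
          gen_lengths(2)[unfolded gen31_def] data_below_theta4(3), where w = "[a, b, c, d]"])
        (use that assms in \<open>simp_all add: term_in_range_def\<close>)
    have "length (vars y) = 1 \<and> length (vars z) = 3 \<or> length (vars y) = 3 \<and> length (vars z) = 1"
      using len length_vars[of y] length_vars[of z] by (auto elim!: oddE)
    then consider a b c d where "y = Var a" "z = \<langle>(Var b) (Var c) (Var d)\<rangle>"
      | a b c d where "y = \<langle>(Var a) (Var b) (Var c)\<rangle>" "z = Var d"
      by (metis length_vars_eq_1 length_vars_eq_3)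
    then show "W y (\<lambda>p. W z (\<lambda>r. weighted_sum v \<psi> theta4 12 i (p @ r) -
        split_value v \<psi> i (length p) (p @ r))) = 0"
      using dist gen13 gen31 by cases (auto simp del: W.simps)
  qed simp
  then show ?thesis by simp
qed

lemma factors_7:
  assumes id45: "\<And>x u. (\<Sum>(c, y, z) \<leftarrow> identity_45_terms.
      scale (of_int c) (tri x (eval_monomial tri u y) (eval_monomial tri u z))) = 0"
    and d: "of_int 12 \<noteq> (0 :: 'a)" "of_int 360 \<noteq> (0 :: 'a)"
  shows "\<exists>\<psi>. factors v 7 \<psi>"
proof -
  obtain \<psi> where \<psi>: "factors v 5 \<psi>" using factors_5[OF d(1)] by blast
  have "\<exists>\<psi>'. factors v (5 + 2) \<psi>'"
  proof (rule factors_extend[OF \<psi>, where \<theta> = "weighted_sum v \<psi> theta6 360"])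
    fix i y z
    assume dist: "distinct (vars \<langle>(Var i) y z\<rangle>)" and len: "length (vars y @ vars z) = Suc 5"
    define \<delta> where "\<delta> k w = weighted_sum v \<psi> theta6 360 i w - split_value v \<psi> i k w" for k w
    have comm3111: "form_sum (\<lambda>t u. split_value v \<psi> i (Suc (pos_index t)) (map (letter w) u)) comm3111 = 0"
      if "distinct w" "length w = 6" for w
      unfolding comm3111_def using that
      by (intro form_sum_commutator_terms[OF \<psi>]) (simp_all add: commutator_terms_def term_in_range_def)
    have comm1311: "form_sum (\<lambda>t u. split_value v \<psi> i (Suc (pos_index t)) (map (letter w) u)) comm1311 = 0"
      if "distinct w" "length w = 6" for w
      unfolding comm1311_def using that
      by (intro form_sum_commutator_terms[OF \<psi>]) (simp_all add: commutator_terms_def term_in_range_def)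
    have in_range: "\<forall>(c, y, z) \<in> set identity_45_terms.
        term_in_range 6 y z \<and> length (vars y) \<le> 5 \<and> length (vars z) \<le> 5"
      by (simp add: identity_45_terms_def term_in_range_def Let_def)
    have rel45: "form_sum (\<lambda>t u. split_value v \<psi> i (Suc (pos_index t)) (map (letter w) u)) rel45 = 0"
      if "distinct w" "length w = 6" for w
      unfolding rel45_def form_sum_normalize using that in_range id45
      by (subst form_sum_split_value[OF \<psi>]) auto
    have null: "form_sum (\<lambda>t u. split_value v \<psi> i (Suc (pos_index t)) (map (letter w) u)) b = 0"
      if "b \<in> {comm3111, comm1311, rel45}" "distinct w" "length w = 6" for b w
      using that comm3111 comm1311 rel45 by auto
    have gen33: "W \<langle>(Var a) (Var b) (Var c)\<rangle> (\<lambda>p. W \<langle>(Var e) (Var f) (Var g)\<rangle> (\<lambda>r. \<delta> (length p) (p @ r))) = 0"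
      if "distinct [i, a, b, c, e, f, g]" for a b c e f g
      unfolding \<delta>_def
      by (rule weighted_sum_correct[OF certifies_gen33[unfolded gen33_def] cert_forms(3) null data_below_theta6(1)
          gen_lengths(3)[unfolded gen33_def] data_below_theta6(2), where w = "[a, b, c, e, f, g]"])
        (use that d in \<open>simp_all add: term_in_range_def\<close>)
    have gen15a: "W (Var a) (\<lambda>p. W \<langle>(Var b) (Var c) \<langle>(Var e) (Var f) (Var g)\<rangle>\<rangle> (\<lambda>r. \<delta> (length p) (p @ r))) = 0"
      if "distinct [i, a, b, c, e, f, g]" for a b c e f g
      unfolding \<delta>_def
      by (rule weighted_sum_correct[OF certifies_gen15a[unfolded gen15a_def] cert_forms(4) null data_below_theta6(1)
          gen_lengths(4)[unfolded gen15a_def] data_below_theta6(3), where w = "[a, b, c, e, f, g]"])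
        (use that d in \<open>simp_all add: term_in_range_def\<close>)
    have gen15b: "W (Var a) (\<lambda>p. W \<langle>(Var b) \<langle>(Var c) (Var e) (Var f)\<rangle> (Var g)\<rangle> (\<lambda>r. \<delta> (length p) (p @ r))) = 0"
      if "distinct [i, a, b, c, e, f, g]" for a b c e f g
      unfolding \<delta>_def
      by (rule weighted_sum_correct[OF certifies_gen15b[unfolded gen15b_def] cert_forms(5) null data_below_theta6(1)
          gen_lengths(5)[unfolded gen15b_def] data_below_theta6(4), where w = "[a, b, c, e, f, g]"])
        (use that d in \<open>simp_all add: term_in_range_def\<close>)
    have gen51a: "W \<langle>(Var a) (Var b) \<langle>(Var c) (Var e) (Var f)\<rangle>\<rangle> (\<lambda>p. W (Var g) (\<lambda>r. \<delta> (length p) (p @ r))) = 0"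
      if "distinct [i, a, b, c, e, f, g]" for a b c e f g
      unfolding \<delta>_def
      by (rule weighted_sum_correct[OF certifies_gen51a[unfolded gen51a_def] cert_forms(6) null data_below_theta6(1)
          gen_lengths(6)[unfolded gen51a_def] data_below_theta6(5), where w = "[a, b, c, e, f, g]"])
        (use that d in \<open>simp_all add: term_in_range_def\<close>)
    have gen51b: "W \<langle>(Var a) \<langle>(Var b) (Var c) (Var e)\<rangle> (Var f)\<rangle> (\<lambda>p. W (Var g) (\<lambda>r. \<delta> (length p) (p @ r))) = 0"
      if "distinct [i, a, b, c, e, f, g]" for a b c e f g
      unfolding \<delta>_def
      by (rule weighted_sum_correct[OF certifies_gen51b[unfolded gen51b_def] cert_forms(7) null data_below_theta6(1)
          gen_lengths(7)[unfolded gen51b_def] data_below_theta6(6), where w = "[a, b, c, e, f, g]"])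
        (use that d in \<open>simp_all add: term_in_range_def\<close>)
    have deg4: thesis
      if "length (vars \<langle>(Var j) m n\<rangle>) = 5"
        "\<And>a b c d. m = Var a \<Longrightarrow> n = \<langle>(Var b) (Var c) (Var d)\<rangle> \<Longrightarrow> thesis"
        "\<And>a b c d. m = \<langle>(Var a) (Var b) (Var c)\<rangle> \<Longrightarrow> n = Var d \<Longrightarrow> thesis"
      for thesis j m n
    proof -
      have "length (vars m) = 1 \<and> length (vars n) = 3 \<or> length (vars m) = 3 \<and> length (vars n) = 1"
        using that(1) length_vars[of m] length_vars[of n] by (auto elim!: oddE)
      then show thesis using that(2,3) length_vars_eq_1 length_vars_eq_3 by metis
    qed
    \<comment> \<open>As a function of m, \<open>W m f\<close> satisfies (1) and (2) for every f, so
      the reduction to a leading variable also works inside a factor of degree 5.\<close>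
    have deg5: "W m f = 0"
      if m: "distinct (vars m)" "length (vars m) = 5"
        and leaf: "\<And>j k n. distinct (vars \<langle>(Var j) k n\<rangle>) \<Longrightarrow> set (vars \<langle>(Var j) k n\<rangle>) = set (vars m) \<Longrightarrow>
          length (vars \<langle>(Var j) k n\<rangle>) = 5 \<Longrightarrow> W \<langle>(Var j) k n\<rangle> f = 0"
      for m and f :: "nat list \<Rightarrow> 'b"
    proof -
      obtain m1 m2 m3 where m123: "m = \<langle>m1 m2 m3\<rangle>" using m by (cases m) auto
      have "W \<langle>m1 m2 m3\<rangle> f = 0"
      proof (rule leaf_first_induct[where F = "\<lambda>m. W m f" and S = "set (vars m)"])
        fix j k n
        assume jkn: "distinct (vars \<langle>(Var j) k n\<rangle>)" "set (vars \<langle>(Var j) k n\<rangle>) = set (vars m)"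
        then have "length (vars \<langle>(Var j) k n\<rangle>) = 5" using m by (metis distinct_card)
        then show "W \<langle>(Var j) k n\<rangle> f = 0" by (rule leaf[OF jkn])
      qed (use m m123 W_jacobi W_derivation in auto)
      then show ?thesis by (simp only: m123)
    qed
    have "length (vars y) = 1 \<and> length (vars z) = 5 \<or> length (vars y) = 3 \<and> length (vars z) = 3 \<or>
        length (vars y) = 5 \<and> length (vars z) = 1"
      using len length_vars[of y] length_vars[of z] by (auto elim!: oddE)
    then consider (15) a where "y = Var a" "length (vars z) = 5"
      | (33) a b c e f g where "y = \<langle>(Var a) (Var b) (Var c)\<rangle>" "z = \<langle>(Var e) (Var f) (Var g)\<rangle>"
      | (51) g where "length (vars y) = 5" "z = Var g"
      by (metis length_vars_eq_1 length_vars_eq_3)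
    then have "W y (\<lambda>p. W z (\<lambda>r. \<delta> (length p) (p @ r))) = 0"
    proof cases
      case 15
      have "W z (\<lambda>r. \<delta> 1 (a # r)) = 0"
      proof (rule deg5)
        fix j k n
        assume jkn: "distinct (vars \<langle>(Var j) k n\<rangle>)" "set (vars \<langle>(Var j) k n\<rangle>) = set (vars z)"
          "length (vars \<langle>(Var j) k n\<rangle>) = 5"
        have dist: "distinct (i # a # vars \<langle>(Var j) k n\<rangle>)"
          using dist jkn 15 by auto
        show "W \<langle>(Var j) k n\<rangle> (\<lambda>r. \<delta> 1 (a # r)) = 0"
          by (rule deg4[OF jkn(3)]) (use dist gen15a[of a j] gen15b[of a j] in auto)
      qed (use dist 15 in auto)
      then show ?thesis by (simp add: 15)
    next
      case 33
      then show ?thesis using dist gen33[of a b c e f g] by (auto simp del: W.simps)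
    next
      case 51
      have "W y (\<lambda>p. \<delta> 5 (p @ [g])) = 0"
      proof (rule deg5)
        fix j k n
        assume jkn: "distinct (vars \<langle>(Var j) k n\<rangle>)" "set (vars \<langle>(Var j) k n\<rangle>) = set (vars y)"
          "length (vars \<langle>(Var j) k n\<rangle>) = 5"
        have dist: "distinct (i # g # vars \<langle>(Var j) k n\<rangle>)"
          using dist jkn 51 by auto
        show "W \<langle>(Var j) k n\<rangle> (\<lambda>p. \<delta> 5 (p @ [g])) = 0"
          by (rule deg4[OF jkn(3)])
            (use dist gen51a[of j _ _ _ _ g] gen51b[of j _ _ _ _ g] in \<open>auto simp: numeral_eq_Suc\<close>)
      qed (use dist 51 in auto)
      \<comment> \<open>\<open>deg5\<close> needs one function of the word, hence the fixed split 5;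
        all words of \<open>y\<close> have this length.\<close>
      also have "W y (\<lambda>p. \<delta> 5 (p @ [g])) = W y (\<lambda>p. \<delta> (length p) (p @ [g]))"
        using 51 by (intro W_cong) (auto dest: mset_eq_length)
      finally show ?thesis by (simp add: 51)
    qed
    then show "W y (\<lambda>p. W z (\<lambda>r. weighted_sum v \<psi> theta6 360 i (p @ r) -
        split_value v \<psi> i (length p) (p @ r))) = 0"
      unfolding \<delta>_def .
  qed simp
  then show ?thesis by simp
qed

end

text \<open>The only primes dividing 12 and 360 are 2, 3 and 5, all excluded as
  characteristics.\<close>

lemma of_int_neq_0_CHAR:
  assumes "CHAR('k::field) = 0 \<or> CHAR('k) > 7"
  shows "of_int 12 \<noteq> (0 :: 'k)" "of_int 360 \<noteq> (0 :: 'k)"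
proof -
  have "of_nat n \<noteq> (0 :: 'k)" if "0 < n" "n \<le> 7" for n
    using assms that by (auto simp: of_nat_eq_0_iff_char_dvd dest: dvd_imp_le)
  from this[of 2] this[of 3] this[of 5] have neq: "(2 :: 'k) \<noteq> 0" "(3 :: 'k) \<noteq> 0" "(5 :: 'k) \<noteq> 0"
    by simp_all
  have "(12 :: 'k) = 2 * 2 * 3" "(360 :: 'k) = 2 * 2 * 2 * 3 * 3 * 5" by simp_all
  then show "of_int 12 \<noteq> (0 :: 'k)" "of_int 360 \<noteq> (0 :: 'k)"
    using neq by (metis mult_eq_0_iff of_int_numeral)+
qed

theorem theorem7p2:
  fixes I :: "'k::field tpoly"
  assumes "CHAR('k) = 0 \<or> CHAR('k) > 7"
    and "multilinear 7 I"
    and "cyclic_commutator_identity I"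
  shows "consequence TYPE('v::ab_group_add)
           {ternary_jacobi, ternary_derivation, identity_45} I"
  unfolding consequence_def
proof (intro allI impI)
  fix scale :: "'k \<Rightarrow> 'v \<Rightarrow> 'v" and tri
  assume alg: "ternary_algebra scale tri"
    and sat: "\<forall>J \<in> {ternary_jacobi, ternary_derivation, identity_45}. satisfies scale tri J"
  interpret ternary_algebra scale tri by (rule alg)
  note linear_extension_simps = linear_extension_add linear_extension_diff linear_extension_single
  have eval: "linear_extension scale (eval_monomial tri v) J = 0"
    if "J \<in> {ternary_jacobi, ternary_derivation, identity_45}" for v J
    using sat that unfolding satisfies_def by blast
  interpret jacobi_derivation_algebra scale tri
  proof
    fix a b c d e
    show "tri a b c + tri b c a + tri c a b = 0"
      using eval[of ternary_jacobi "(!) [a, b, c]"]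
      by (simp add: ternary_jacobi_def Let_def linear_extension_simps numeral_eq_Suc)
    show "tri (tri a b c) d e = tri (tri a d e) b c + tri a (tri b d e) c + tri a b (tri c d e)"
      using eval[of ternary_derivation "(!) [a, b, c, d, e]"]
      by (simp add: ternary_derivation_def Let_def linear_extension_simps numeral_eq_Suc)
  qed
  have id45: "(\<Sum>(c, y, z) \<leftarrow> identity_45_terms.
      scale (of_int c) (tri x (eval_monomial tri u y) (eval_monomial tri u z))) = 0" for x u
    \<comment> \<open>\<open>case_nat x u\<close> assigns x to the variable a and shifts the others
      down by one, matching the renumbering of b to g in \<open>identity_45_terms\<close>.\<close>
    using eval[of identity_45 "case_nat x u"]
    by (simp add: identity_45_def identity_45_terms_def Let_def linear_extension_simps numeral_eq_Suc
        algebra_simps)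
  show "satisfies scale tri I"
    unfolding satisfies_def
  proof
    fix v
    obtain \<psi> where \<psi>: "factors v 7 \<psi>"
      using factors_7[OF id45 of_int_neq_0_CHAR[OF assms(1)]] by blast
    let ?X = "\<lambda>i. Poly_Mapping.single (Word [i]) (1 :: 'k)"
    have "eval_monomial tri v m = word_sum scale \<psi> (eval_monomial cyclic_commutator ?X m)"
      if "m \<in> Poly_Mapping.keys I" for m
    proof -
      have "distinct (vars m)" "set (vars m) = {..<7}"
        using assms(2) that by (auto simp: multilinear_def)
      then have "length (vars m) = 7" by (metis card_lessThan distinct_card)
      with \<open>distinct (vars m)\<close> show ?thesis
        using \<psi> by (simp add: factors_def word_sum_eval_monomial)
    qed
    \<comment> \<open>The value of \<open>I\<close> is the linear functional given by
      \<open>\<psi>\<close>, applied to the expansion of \<open>I\<close> in the free algebra, and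
      this expansion is zero.\<close>
    then have "linear_extension scale (eval_monomial tri v) I =
        word_sum scale \<psi> (linear_extension free_scale (eval_monomial cyclic_commutator ?X) I)"
      by (simp add: linear_extension_def[of scale _ I] linear_extension_def[of free_scale]
          word_sum_def linear_extension_sum linear_extension_free_scale)
    also have "linear_extension free_scale (eval_monomial cyclic_commutator ?X) I = 0"
      using assms(3) by (simp add: cyclic_commutator_identity_def satisfies_def)
    finally show "linear_extension scale (eval_monomial tri v) I = 0"
      by (simp add: word_sum_def linear_extension_0)
  qed
qed

end
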